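(* Let $(\kappa,\rho)\in W$ and $x\in(0,\infty)$. A quadruple sequence $(a,b,m,n):\mathbb{Z}\to\mathbb{R}^4$ is an element of $\mathrm{ABMN}(\kappa,\rho)$ satisfying $m_{-\infty}=n_\infty=0$ and $\frac{n_{-1}-n_0}{m_0-m_{-1}}=x$ if and only if $(a,b,m,n)$ is the dilation (multiplication of all four components by $\mu$) by some factor $\mu\in(0,\infty)$ of the sequence $\big((a^{\rm def}_i(x),b^{\rm def}_i(x),m^{\rm def}_i(x),n^{\rm def}_i(x)):i\in\mathbb{Z}\big)$. The value $m_0-m_{-1}$ of the solution is equal to $\mu\kappa$.
   Context: $W=\{(\kappa,\rho)\in(0,1]\times(0,\infty):\rho^2\kappa\le1\}$. $\mathrm{ABMN}(\kappa,\rho)$ is the set of sequences $(a_i,b_i,m_i,n_i)_{i\in\mathbb{Z}}$ with values in $(0,\infty)^2\times\mathbb{R}^2$ satisfying, for every $i\in\mathbb{Z}$, $$2(a_i^\rho+b_i^\rho)(m_i+a_i)=\big(a_i^\rho(1-\kappa)+b_i^\rho(1+\kappa)\big)m_{i-1}+\big(a_i^\rho(1+\kappa)+b_i^\rho(1-\kappa)\big)m_{i+1},$$ $$2(a_i^\rho+b_i^\rho)(n_i+b_i)=\big(a_i^\rho(1-\kappa)+b_i^\rho(1+\kappa)\big)n_{i-1}+\big(a_i^\rho(1+\kappa)+b_i^\rho(1-\kappa)\big)n_{i+1},$$ $$(a_i^\rho+b_i^\rho)^2=\rho\kappa\,a_i^{\rho-1}b_i^\rho\,(m_{i+1}-m_{i-1}),\qquad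 (a_i^\rho+b_i^\rho)^2=\rho\kappa\,a_i^{\rho}b_i^{\rho-1}\,(n_{i-1}-n_{i+1}).$$ Write $m_{\pm\infty}=\lim_{k\to\infty}m_{\pm k}$ and $n_{\pm\infty}=\lim_{k\to\infty}n_{\pm k}$. Basic functions of $\beta\in(0,\infty)$: $$\gamma(\kappa,\rho,\beta)=\frac{(1-\kappa)\beta^{2\rho}+2(1-\rho\kappa)\beta^\rho+1+\kappa}{2(1+\beta^\rho)^2},\qquad \delta(\kappa,\rho,\beta)=\frac{(1-\kappa)\beta^{2\rho}+2(1+\rho\kappa)\beta^\rho+1+\kappa}{2(1+\beta^\rho)^2},$$ $$\phi_0(\kappa,\rho,\beta)=\frac{\beta\big((1-\kappa)\beta^{2\rho}+2(1+\kappa\rho)\beta^\rho+1+\kappa\big)}{(1-\kappa)\beta^{2\rho}+2(1-\kappa\rho)\beta^\rho+1+\kappa},\qquad \phi_1(\kappa,\rho,\beta)=\frac{\beta\big((1+\kappa)\beta^{2\rho}+2(1-\kappa\rho)\beta^\rho+1-\kappa\big)}{(1+\kappa)\beta^{2\rho}+2(1+\kappa\rho)\beta^\rho+1-\kappa}.$$ For $(\kappa,\rho)\in W$, $\beta\mapsto\phi_0$ and $\beta\mapsto\phi_1$ are increasing bijections of $(0,\infty)$. For $x\in(0,\infty)$ let $\beta$ be the unique value with $\phi_0(\kappa,\rho,\beta)=x$, and set $s(x)=\phi_1(\kappa,\rho,\beta)$, $c(x)=1/\gamma(\kappa,\rho,\beta)$, $d(x)=1/\delta(\kappa,\rho,\beta)$.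 The map $s$ is a bijection of $(0,\infty)$; for $i\in\mathbb{Z}$, $s_i$ denotes its $i$-fold iterate ($s_0$ is the identity, and negative $i$ denotes iterates of the inverse). Set $c_i(x)=c(s_i(x))$ and $d_i(x)=d(s_i(x))$. Product convention: $\prod_{i=0}^kh_i$ is the usual product for $k\ge0$, equals $1$ for $k=-1$, and equals $h_{k+1}^{-1}\cdots h_{-1}^{-1}$ for $k\le-2$. Default sequences: $m^{\rm def}(x)$ and $n^{\rm def}(x)$ are determined by $$\lim_{k\to-\infty}m^{\rm def}_k(x)=0,\quad m^{\rm def}_{k+1}(x)-m^{\rm def}_k(x)=\kappa\prod_{i=0}^k\big(c_i(x)-1\big),$$ $$\lim_{k\to\infty}n^{\rm def}_k(x)=0,\quad n^{\rm def}_k(x)-n^{\rm def}_{k+1}(x)=\kappa x\prod_{i=0}^k\big(d_i(x)-1\big)\qquad(k\in\mathbb{Z}).$$ With $M_i=m^{\rm def}_{i+1}(x)-m^{\rm def}_{i-1}(x)$ and $N_i=n^{\rm def}_{i-1}(x)-n^{\rm def}_{i+1}(x)$, $$a^{\rm def}_i(x)=\frac{\kappa\rho M_i^{1+\rho}N_i^\rho}{(M_i^\rho+N_i^\rho)^2},\qquad b^{\rm def}_i(x)=\frac{\kappa\rho M_i^\rho N_i^{1+\rho}}{(M_i^\rho+N_i^\rho)^2}.$$ *)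

theory Defs
  imports "HOL-Analysis.Analysis"
begin

definition W :: "(real \<times> real) set" where
  "W = {(\<kappa>, \<rho>). 0 < \<kappa> \<and> \<kappa> \<le> 1 \<and> 0 < \<rho> \<and> \<rho>^2 * \<kappa> \<le> 1}"

type_synonym quad_seq = "(int \<Rightarrow> real) \<times> (int \<Rightarrow> real) \<times> (int \<Rightarrow> real) \<times> (int \<Rightarrow> real)"

definition ABMN :: "real \<Rightarrow> real \<Rightarrow> quad_seq set" where
  "ABMN \<kappa> \<rho> = {(a, b, m, n). \<forall>i.
     0 < a i \<and> 0 < b i \<and>
     2 * (a i powr \<rho> + b i powr \<rho>) * (m i + a i) =
       (a i powr \<rho> * (1 - \<kappa>) + b i powr \<rho> * (1 + \<kappa>)) * m (i - 1) +
       (a i powr \<rho> * (1 + \<kappa>) + b i powr \<rho> * (1 - \<kappa>)) * m (i + 1) \<and>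
     2 * (a i powr \<rho> + b i powr \<rho>) * (n i + b i) =
       (a i powr \<rho> * (1 - \<kappa>) + b i powr \<rho> * (1 + \<kappa>)) * n (i - 1) +
       (a i powr \<rho> * (1 + \<kappa>) + b i powr \<rho> * (1 - \<kappa>)) * n (i + 1) \<and>
     (a i powr \<rho> + b i powr \<rho>)^2 =
       \<rho> * \<kappa> * a i powr (\<rho> - 1) * b i powr \<rho> * (m (i + 1) - m (i - 1)) \<and>
     (a i powr \<rho> + b i powr \<rho>)^2 =
       \<rho> * \<kappa> * a i powr \<rho> * b i powr (\<rho> - 1) * (n (i - 1) - n (i + 1))}"

definition dilation :: "real \<Rightarrow> quad_seq \<Rightarrow> quad_seq" where
  "dilation \<mu> = (\<lambda>(a, b, m, n).
     (\<lambda>i. \<mu> * a i, \<lambda>i. \<mu> * b i, \<lambda>i. \<mu> * m i, \<lambda>i. \<mu> * n i))"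

definition gamma_fn :: "real \<Rightarrow> real \<Rightarrow> real \<Rightarrow> real" where
  "gamma_fn \<kappa> \<rho> \<beta> =
     ((1 - \<kappa>) * \<beta> powr (2 * \<rho>) + 2 * (1 - \<rho> * \<kappa>) * \<beta> powr \<rho> + 1 + \<kappa>) /
     (2 * (1 + \<beta> powr \<rho>)^2)"

definition delta_fn :: "real \<Rightarrow> real \<Rightarrow> real \<Rightarrow> real" where
  "delta_fn \<kappa> \<rho> \<beta> =
     ((1 - \<kappa>) * \<beta> powr (2 * \<rho>) + 2 * (1 + \<rho> * \<kappa>) * \<beta> powr \<rho> + 1 + \<kappa>) /
     (2 * (1 + \<beta> powr \<rho>)^2)"

definition phi0 :: "real \<Rightarrow> real \<Rightarrow> real \<Rightarrow> real" where
  "phi0 \<kappa> \<rho> \<beta> =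
     \<beta> * ((1 - \<kappa>) * \<beta> powr (2 * \<rho>) + 2 * (1 + \<kappa> * \<rho>) * \<beta> powr \<rho> + 1 + \<kappa>) /
     ((1 - \<kappa>) * \<beta> powr (2 * \<rho>) + 2 * (1 - \<kappa> * \<rho>) * \<beta> powr \<rho> + 1 + \<kappa>)"

definition phi1 :: "real \<Rightarrow> real \<Rightarrow> real \<Rightarrow> real" where
  "phi1 \<kappa> \<rho> \<beta> =
     \<beta> * ((1 + \<kappa>) * \<beta> powr (2 * \<rho>) + 2 * (1 - \<kappa> * \<rho>) * \<beta> powr \<rho> + 1 - \<kappa>) /
     ((1 + \<kappa>) * \<beta> powr (2 * \<rho>) + 2 * (1 + \<kappa> * \<rho>) * \<beta> powr \<rho> + 1 - \<kappa>)"

definition beta_of :: "real \<Rightarrow> real \<Rightarrow> real \<Rightarrow> real" where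
  "beta_of \<kappa> \<rho> x = (THE \<beta>. 0 < \<beta> \<and> phi0 \<kappa> \<rho> \<beta> = x)"

definition s_map :: "real \<Rightarrow> real \<Rightarrow> real \<Rightarrow> real" where
  "s_map \<kappa> \<rho> x = phi1 \<kappa> \<rho> (beta_of \<kappa> \<rho> x)"

definition c_fn :: "real \<Rightarrow> real \<Rightarrow> real \<Rightarrow> real" where
  "c_fn \<kappa> \<rho> x = 1 / gamma_fn \<kappa> \<rho> (beta_of \<kappa> \<rho> x)"

definition d_fn :: "real \<Rightarrow> real \<Rightarrow> real \<Rightarrow> real" where
  "d_fn \<kappa> \<rho> x = 1 / delta_fn \<kappa> \<rho> (beta_of \<kappa> \<rho> x)"

definition s_iter :: "real \<Rightarrow> real \<Rightarrow> int \<Rightarrow> real \<Rightarrow> real" where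
  "s_iter \<kappa> \<rho> i =
     (if 0 \<le> i then s_map \<kappa> \<rho> ^^ nat i
      else inv_into {0<..} (s_map \<kappa> \<rho>) ^^ nat (- i))"

definition c_iter :: "real \<Rightarrow> real \<Rightarrow> int \<Rightarrow> real \<Rightarrow> real" where
  "c_iter \<kappa> \<rho> i x = c_fn \<kappa> \<rho> (s_iter \<kappa> \<rho> i x)"

definition d_iter :: "real \<Rightarrow> real \<Rightarrow> int \<Rightarrow> real \<Rightarrow> real" where
  "d_iter \<kappa> \<rho> i x = d_fn \<kappa> \<rho> (s_iter \<kappa> \<rho> i x)"

text \<open>The product of \<open>h i\<close> for \<open>i\<close> running from \<open>0\<close> to an arbitrary integer \<open>k\<close>;
  for \<open>k = -1\<close> it is the empty product.\<close>

definition prod_to :: "(int \<Rightarrow> real) \<Rightarrow> int \<Rightarrow> real" where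
  "prod_to h k =
     (if 0 \<le> k then \<Prod>i\<in>{0..k}. h i else \<Prod>i\<in>{k+1..-1}. inverse (h i))"

definition m_def_seq :: "real \<Rightarrow> real \<Rightarrow> real \<Rightarrow> int \<Rightarrow> real" where
  "m_def_seq \<kappa> \<rho> x = (THE m. (m \<longlongrightarrow> 0) at_bot \<and>
     (\<forall>k. m (k + 1) - m k = \<kappa> * prod_to (\<lambda>i. c_iter \<kappa> \<rho> i x - 1) k))"

definition n_def_seq :: "real \<Rightarrow> real \<Rightarrow> real \<Rightarrow> int \<Rightarrow> real" where
  "n_def_seq \<kappa> \<rho> x = (THE n. (n \<longlongrightarrow> 0) at_top \<and>
     (\<forall>k. n k - n (k + 1) = \<kappa> * x * prod_to (\<lambda>i. d_iter \<kappa> \<rho> i x - 1) k))"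

definition a_def_seq :: "real \<Rightarrow> real \<Rightarrow> real \<Rightarrow> int \<Rightarrow> real" where
  "a_def_seq \<kappa> \<rho> x i =
     (let M = m_def_seq \<kappa> \<rho> x (i + 1) - m_def_seq \<kappa> \<rho> x (i - 1);
          N = n_def_seq \<kappa> \<rho> x (i - 1) - n_def_seq \<kappa> \<rho> x (i + 1)
      in \<kappa> * \<rho> * M powr (1 + \<rho>) * N powr \<rho> / (M powr \<rho> + N powr \<rho>)^2)"

definition b_def_seq :: "real \<Rightarrow> real \<Rightarrow> real \<Rightarrow> int \<Rightarrow> real" where
  "b_def_seq \<kappa> \<rho> x i =
     (let M = m_def_seq \<kappa> \<rho> x (i + 1) - m_def_seq \<kappa> \<rho> x (i - 1);
          N = n_def_seq \<kappa> \<rho> x (i - 1) - n_def_seq \<kappa> \<rho> x (i + 1)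
      in \<kappa> * \<rho> * M powr \<rho> * N powr (1 + \<rho>) / (M powr \<rho> + N powr \<rho>)^2)"

definition default_seq :: "real \<Rightarrow> real \<Rightarrow> real \<Rightarrow> quad_seq" where
  "default_seq \<kappa> \<rho> x =
     (a_def_seq \<kappa> \<rho> x, b_def_seq \<kappa> \<rho> x, m_def_seq \<kappa> \<rho> x, n_def_seq \<kappa> \<rho> x)"

end

theory Submission
  imports Defs
begin

text \<open>
  Put \<open>M = m\<^sub>i\<^sub>+\<^sub>1 - m\<^sub>i\<^sub>-\<^sub>1\<close>, \<open>N = n\<^sub>i\<^sub>-\<^sub>1 - n\<^sub>i\<^sub>+\<^sub>1\<close> and \<open>\<beta> = b\<^sub>i / a\<^sub>i\<close>. The last two equations say that
  \<open>\<beta> = N / M\<close> and express \<open>a\<^sub>i\<close>, \<open>b\<^sub>i\<close> through \<open>M\<close> and \<open>N\<close>; the first two then become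
  \<open>m\<^sub>i - m\<^sub>i\<^sub>-\<^sub>1 = M \<gamma>(\<beta>)\<close> and \<open>n\<^sub>i\<^sub>-\<^sub>1 - n\<^sub>i = N \<delta>(\<beta>)\<close>. Since \<open>\<phi>\<^sub>0(\<beta>) = \<beta> \<delta> / \<gamma>\<close> and
  \<open>\<phi>\<^sub>1(\<beta>) = \<beta> (1 - \<delta>) / (1 - \<gamma>)\<close>, the quotients \<open>(n\<^sub>i\<^sub>-\<^sub>1 - n\<^sub>i) / (m\<^sub>i - m\<^sub>i\<^sub>-\<^sub>1)\<close> form an orbit of \<open>s\<close>,
  and consecutive differences of \<open>m\<close> and \<open>n\<close> have quotients \<open>c\<^sub>i - 1\<close> and \<open>d\<^sub>i - 1\<close>. So the
  differences are determined up to a common factor, and the conditions at infinity do the rest.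

  The default sequences exist because \<open>\<phi>\<^sub>1(\<beta>) < \<beta> < \<phi>\<^sub>0(\<beta>)\<close> forces \<open>\<beta>\<close> to tend to \<open>0\<close> along the
  forward orbit and to \<open>\<infinity>\<close> along the backward one, where the differences decay geometrically
  with limiting ratio \<open>(1 - \<kappa>) / (1 + \<kappa>)\<close>. The symmetry \<open>\<phi>\<^sub>1(1 / \<beta>) = 1 / \<phi>\<^sub>0(\<beta>)\<close> reduces the
  backward orbit to the forward one.
\<close>

section \<open>The basic functions\<close>

locale weights =
  fixes \<kappa> \<rho> :: real
  assumes weights: "(\<kappa>, \<rho>) \<in> W"
begin

lemma kappa_pos: "0 < \<kappa>" and kappa_le_1: "\<kappa> \<le> 1" and rho_pos: "0 < \<rho>"
  and rho_sq_kappa_le_1: "\<rho>\<^sup>2 * \<kappa> \<le> 1"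
  using weights by (auto simp: W_def)

lemma rho_kappa_pos: "0 < \<rho> * \<kappa>"
  using kappa_pos rho_pos by simp

text \<open>Keeps the middle coefficient \<open>1 - \<rho> * \<kappa>\<close> nonnegative, on which
  \<open>gamma_pos\<close> and \<open>delta_less_1\<close> rest.\<close>

lemma rho_kappa_le_1: "\<rho> * \<kappa> \<le> 1"
proof -
  have "(\<rho> * \<kappa>)\<^sup>2 = (\<rho>\<^sup>2 * \<kappa>) * \<kappa>"
    by (simp add: power2_eq_square)
  also have "\<dots> \<le> 1"
    using mult_mono[OF rho_sq_kappa_le_1 kappa_le_1] kappa_pos by simp
  finally show ?thesis
    using power2_le_imp_le[of "\<rho> * \<kappa>" 1] by simp
qed

abbreviation "\<gamma> \<equiv> gamma_fn \<kappa> \<rho>"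
abbreviation "\<delta> \<equiv> delta_fn \<kappa> \<rho>"
abbreviation "\<phi>\<^sub>0 \<equiv> phi0 \<kappa> \<rho>"
abbreviation "\<phi>\<^sub>1 \<equiv> phi1 \<kappa> \<rho>"

lemma powr_double: "y powr (2 * \<rho>) = (y powr \<rho>)\<^sup>2" for y :: real
  by (simp add: power2_eq_square flip: powr_add)

lemma denominator_pos: "0 < 2 * (1 + \<beta> powr \<rho>)\<^sup>2"
  by (smt (verit) powr_ge_zero zero_less_power)

lemma one_minus_gamma:
  assumes "0 < \<beta>"
  shows "1 - \<gamma> \<beta> =
    ((1 + \<kappa>) * (\<beta> powr \<rho>)\<^sup>2 + 2 * (1 + \<rho> * \<kappa>) * \<beta> powr \<rho> + 1 - \<kappa>) / (2 * (1 + \<beta> powr \<rho>)\<^sup>2)"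
proof -
  have "(1 + \<beta> powr \<rho>)\<^sup>2 \<noteq> 0" using denominator_pos[of \<beta>] by simp
  then show ?thesis
    unfolding gamma_fn_def powr_double by (simp add: field_simps power2_eq_square)
qed

lemma one_minus_delta:
  assumes "0 < \<beta>"
  shows "1 - \<delta> \<beta> =
    ((1 + \<kappa>) * (\<beta> powr \<rho>)\<^sup>2 + 2 * (1 - \<rho> * \<kappa>) * \<beta> powr \<rho> + 1 - \<kappa>) / (2 * (1 + \<beta> powr \<rho>)\<^sup>2)"
proof -
  have "(1 + \<beta> powr \<rho>)\<^sup>2 \<noteq> 0" using denominator_pos[of \<beta>] by simp
  then show ?thesis
    unfolding delta_fn_def powr_double by (simp add: field_simps power2_eq_square)
qed

section \<open>Bounds on \<open>\<gamma>\<close>, \<open>\<delta>\<close>,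
  \<open>\<phi>\<^sub>0\<close> and \<open>\<phi>\<^sub>1\<close>\<close>

lemma gamma_pos: "0 < \<gamma> \<beta>" if "0 < \<beta>"
  unfolding gamma_fn_def powr_double
proof (intro divide_pos_pos denominator_pos)
  have "0 \<le> (1 - \<kappa>) * (\<beta> powr \<rho>)\<^sup>2" "0 \<le> 2 * (1 - \<rho> * \<kappa>) * \<beta> powr \<rho>"
    using kappa_le_1 rho_kappa_le_1 by simp_all
  then show "0 < (1 - \<kappa>) * (\<beta> powr \<rho>)\<^sup>2 + 2 * (1 - \<rho> * \<kappa>) * \<beta> powr \<rho> + 1 + \<kappa>"
    using kappa_pos by linarith
qed

lemma gamma_less_delta: "\<gamma> \<beta> < \<delta> \<beta>" if "0 < \<beta>"
  unfolding gamma_fn_def delta_fn_def using rho_kappa_pos that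
  by (intro divide_strict_right_mono denominator_pos) simp

lemma delta_less_1: "\<delta> \<beta> < 1" if "0 < \<beta>"
proof -
  have "0 < 1 - \<delta> \<beta>"
    unfolding one_minus_delta[OF that]
  proof (intro divide_pos_pos denominator_pos)
    have "0 < (1 + \<kappa>) * (\<beta> powr \<rho>)\<^sup>2" "0 \<le> 2 * (1 - \<rho> * \<kappa>) * \<beta> powr \<rho>"
      using kappa_pos rho_kappa_le_1 that by simp_all
    then show "0 < (1 + \<kappa>) * (\<beta> powr \<rho>)\<^sup>2 + 2 * (1 - \<rho> * \<kappa>) * \<beta> powr \<rho> + 1 - \<kappa>"
      using kappa_le_1 by linarith
  qed
  then show ?thesis by simp
qed

lemma delta_pos: "0 < \<delta> \<beta>" and gamma_less_1: "\<gamma> \<beta> < 1" if "0 < \<beta>"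
  using gamma_pos[OF that] gamma_less_delta[OF that] delta_less_1[OF that] by auto

lemma phi0_eq: "\<phi>\<^sub>0 \<beta> = \<beta> * \<delta> \<beta> / \<gamma> \<beta>" if "0 < \<beta>"
proof -
  have "(1 + \<beta> powr \<rho>)\<^sup>2 \<noteq> 0" using denominator_pos[of \<beta>] by simp
  then show ?thesis
    unfolding phi0_def gamma_fn_def delta_fn_def by (simp add: mult.commute[of \<kappa> \<rho>])
qed

lemma phi1_eq: "\<phi>\<^sub>1 \<beta> = \<beta> * (1 - \<delta> \<beta>) / (1 - \<gamma> \<beta>)" if "0 < \<beta>"
proof -
  have "(1 + \<beta> powr \<rho>)\<^sup>2 \<noteq> 0" using denominator_pos[of \<beta>] by simp
  then show ?thesis
    unfolding phi1_def one_minus_gamma[OF that] one_minus_delta[OF that] powr_double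
    by (simp add: mult.commute[of \<kappa> \<rho>])
qed

lemma phi0_pos: "0 < \<phi>\<^sub>0 \<beta>" and phi1_pos: "0 < \<phi>\<^sub>1 \<beta>" if "0 < \<beta>"
  using that gamma_pos delta_pos gamma_less_1 delta_less_1 by (simp_all add: phi0_eq phi1_eq)

lemma phi0_greater: "\<beta> < \<phi>\<^sub>0 \<beta>" if "0 < \<beta>"
  using that gamma_pos[OF that] gamma_less_delta[OF that] by (simp add: phi0_eq field_simps)

lemma phi1_less: "\<phi>\<^sub>1 \<beta> < \<beta>" if "0 < \<beta>"
  using that gamma_less_1[OF that] gamma_less_delta[OF that] by (simp add: phi1_eq field_simps)

text \<open>Expanding the fraction by \<open>(\<beta> powr \<rho>)\<^sup>2\<close> reverses the
  order of the coefficients. Behind this lies the exchange of the two players combined with reversal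
  of the line.\<close>

lemma delta_inverse: "\<delta> (inverse \<beta>) = 1 - \<gamma> \<beta>" if "0 < \<beta>"
proof -
  define B where "B = \<beta> powr \<rho>"
  have B: "0 < B" "inverse \<beta> powr \<rho> = inverse B"
    using that by (simp_all add: B_def inverse_powr)
  have "(1 + B)\<^sup>2 \<noteq> 0" "(1 + inverse B)\<^sup>2 \<noteq> 0"
    using B(1) by (smt (verit) positive_imp_inverse_positive zero_less_power)+
  then show ?thesis
    unfolding one_minus_gamma[OF that] delta_fn_def powr_double B(2) unfolding B_def[symmetric]
    using B(1) by (simp add: frac_eq_eq field_simps) (simp add: algebra_simps eval_nat_numeral)
qed

lemma gamma_inverse: "\<gamma> (inverse \<beta>) = 1 - \<delta> \<beta>" if "0 < \<beta>"
  using delta_inverse[of "inverse \<beta>"] that by simp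

lemma phi1_inverse: "\<phi>\<^sub>1 (inverse \<beta>) = inverse (\<phi>\<^sub>0 \<beta>)" if "0 < \<beta>"
  using that by (simp add: phi1_eq phi0_eq gamma_inverse delta_inverse divide_inverse)

lemma phi0_inverse: "\<phi>\<^sub>0 (inverse \<beta>) = inverse (\<phi>\<^sub>1 \<beta>)" if "0 < \<beta>"
  using phi1_inverse[of "inverse \<beta>"] that by simp

text \<open>The numerator of the logarithmic derivative of \<open>\<phi>\<^sub>0\<close>. It is affine in \<open>t = \<rho>\<^sup>2 \<kappa>\<close>
  and positive at both ends of \<open>0 \<le> t \<le> 1\<close>.\<close>

lemma log_derivative_numerator_pos:
  assumes "0 < B"
  shows "0 < ((1 - \<kappa>) * B\<^sup>2 + 2 * B + 1 + \<kappa>)\<^sup>2 - 4 * \<kappa>\<^sup>2 * \<rho>\<^sup>2 * B\<^sup>2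
    + 4 * \<kappa> * \<rho>\<^sup>2 * B * (1 + \<kappa> - (1 - \<kappa>) * B\<^sup>2)"
proof -
  define t where "t = \<rho>\<^sup>2 * \<kappa>"
  define R where "R = (1 - \<kappa>) * B\<^sup>2 + 2 * B + 1 + \<kappa>"
  have t: "0 \<le> t" "t \<le> 1"
    using rho_sq_kappa_le_1 kappa_pos by (auto simp: t_def)
  have "0 \<le> (1 - \<kappa>) * B\<^sup>2"
    using kappa_le_1 by simp
  then have R: "0 < R"
    unfolding R_def using assms kappa_pos by linarith
  \<comment> \<open>\<open>E\<close> is the value at \<open>t = 1\<close>: there the cubic terms in
    \<open>B\<close> cancel and no coefficient is negative.\<close>
  define E where "E = (1 - \<kappa>)\<^sup>2 * B^4 + (2 * (1 - \<kappa>) * (3 + \<kappa>)) * B\<^sup>2 + 8 * (1 + \<kappa>) * B + (1 + \<kappa>)\<^sup>2"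
  have E: "0 < E"
    unfolding E_def using assms kappa_pos kappa_le_1 by (auto intro!: add_nonneg_pos)
  have "R\<^sup>2 - 4 * \<kappa>\<^sup>2 * \<rho>\<^sup>2 * B\<^sup>2 + 4 * \<kappa> * \<rho>\<^sup>2 * B * (1 + \<kappa> - (1 - \<kappa>) * B\<^sup>2)
      = (1 - t) * R\<^sup>2 + t * E"
    unfolding R_def E_def t_def by algebra
  also have "\<dots> > 0"
    using t R E by (cases "t = 0") (auto intro!: add_nonneg_pos)
  finally show ?thesis unfolding R_def .
qed

text \<open>In the coordinate \<open>u = ln \<beta>\<close> the derivative of
  \<open>F = ln \<phi>\<^sub>0\<close> is a rational function of
  \<open>B = \<beta> powr \<rho>\<close>. Clearing its positive denominators leaves the polynomial
  of \<open>log_derivative_numerator_pos\<close>.\<close>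

lemma phi0_strict_mono:
  assumes "0 < y" "y < z"
  shows "\<phi>\<^sub>0 y < \<phi>\<^sub>0 z"
proof -
  define P where "P = (\<lambda>B. (1 - \<kappa>) * B\<^sup>2 + 2 * (1 + \<kappa> * \<rho>) * B + 1 + \<kappa>)"
  define Q where "Q = (\<lambda>B. (1 - \<kappa>) * B\<^sup>2 + 2 * (1 - \<kappa> * \<rho>) * B + 1 + \<kappa>)"
  define F where "F = (\<lambda>u. u + ln (P (exp (\<rho> * u))) - ln (Q (exp (\<rho> * u))))"
  have pos: "0 < P B" "0 < Q B" if "0 < B" for B
    unfolding P_def Q_def using that kappa_pos kappa_le_1 rho_kappa_pos rho_kappa_le_1
    by (auto simp: mult.commute[of \<kappa> \<rho>] intro!: add_nonneg_pos)
  have phi0_F: "\<phi>\<^sub>0 w = exp (F (ln w))" if "0 < w" for w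
  proof -
    have B: "exp (\<rho> * ln w) = w powr \<rho>" using that by (simp add: powr_def)
    have "exp (F (ln w)) = w * P (w powr \<rho>) / Q (w powr \<rho>)"
      unfolding F_def B using that pos[of "w powr \<rho>"] by (simp add: exp_add exp_diff)
    then show ?thesis
      by (simp add: phi0_def P_def Q_def powr_double)
  qed
  have "\<exists>D. (F has_real_derivative D) (at u) \<and> D > 0" for u
  proof -
    define B where "B = exp (\<rho> * u)"
    define D where "D = 1 + (2 * (1 - \<kappa>) * B + 2 * (1 + \<kappa> * \<rho>)) * (\<rho> * B) / P B
      - (2 * (1 - \<kappa>) * B + 2 * (1 - \<kappa> * \<rho>)) * (\<rho> * B) / Q B"
    have B: "0 < B" by (simp add: B_def)
    have dP: "((\<lambda>u. P (exp (\<rho> * u))) has_real_derivative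
        (2 * (1 - \<kappa>) * B + 2 * (1 + \<kappa> * \<rho>)) * (\<rho> * B)) (at u)"
      unfolding P_def B_def by (auto intro!: derivative_eq_intros simp: algebra_simps)
    have dQ: "((\<lambda>u. Q (exp (\<rho> * u))) has_real_derivative
        (2 * (1 - \<kappa>) * B + 2 * (1 - \<kappa> * \<rho>)) * (\<rho> * B)) (at u)"
      unfolding Q_def B_def by (auto intro!: derivative_eq_intros simp: algebra_simps)
    have "(F has_real_derivative D) (at u)"
      unfolding F_def D_def using pos[OF B]
      by (auto intro!: derivative_eq_intros dP dQ simp: B_def[symmetric])
    moreover have "D * (P B * Q B) = ((1 - \<kappa>) * B\<^sup>2 + 2 * B + 1 + \<kappa>)\<^sup>2 - 4 * \<kappa>\<^sup>2 * \<rho>\<^sup>2 * B\<^sup>2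
        + 4 * \<kappa> * \<rho>\<^sup>2 * B * (1 + \<kappa> - (1 - \<kappa>) * B\<^sup>2)"
    proof -
      have "D * (P B * Q B) = P B * Q B + (2 * (1 - \<kappa>) * B + 2 * (1 + \<kappa> * \<rho>)) * (\<rho> * B) * Q B
          - (2 * (1 - \<kappa>) * B + 2 * (1 - \<kappa> * \<rho>)) * (\<rho> * B) * P B"
        unfolding D_def using pos[OF B] by (simp add: field_simps)
      then show ?thesis unfolding P_def Q_def by algebra
    qed
    then have "D > 0"
      using log_derivative_numerator_pos[OF B] pos[OF B] by (metis mult_pos_pos zero_less_mult_pos2)
    ultimately show ?thesis by blast
  qed
  then have "F (ln y) < F (ln z)"
    using assms by (intro DERIV_pos_imp_increasing[of "ln y" "ln z" F]) (simp, blast)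
  then show ?thesis
    using assms by (simp add: phi0_F)
qed

lemma phi0_less_iff: "\<phi>\<^sub>0 y < \<phi>\<^sub>0 z \<longleftrightarrow> y < z" if "0 < y" "0 < z"
  using that phi0_strict_mono[of y z] phi0_strict_mono[of z y] by (cases y z rule: linorder_cases) auto

section \<open>Continuity, limits at zero, and surjectivity of \<open>\<phi>\<^sub>0\<close>\<close>

lemma isCont_gamma: "isCont \<gamma> \<beta>" and isCont_delta: "isCont \<delta> \<beta>" if "0 < \<beta>"
proof -
  have "2 * (1 + \<beta> powr \<rho>)\<^sup>2 \<noteq> 0" using denominator_pos[of \<beta>] by linarith
  then show "isCont \<gamma> \<beta>" "isCont \<delta> \<beta>"
    unfolding gamma_fn_def[abs_def] delta_fn_def[abs_def] using that
    by (intro continuous_intros; simp)+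
qed

lemma isCont_phi0: "isCont \<phi>\<^sub>0 \<beta>" if "0 < \<beta>"
proof -
  have "isCont (\<lambda>\<beta>. \<beta> * \<delta> \<beta> / \<gamma> \<beta>) \<beta>"
    using gamma_pos[OF that] isCont_gamma[OF that] isCont_delta[OF that]
    by (intro continuous_intros) auto
  moreover have "\<forall>\<^sub>F \<beta> in nhds \<beta>. \<phi>\<^sub>0 \<beta> = \<beta> * \<delta> \<beta> / \<gamma> \<beta>"
    using eventually_nhds_in_open[of "{0<..}" \<beta>] that by (auto elim!: eventually_mono simp: phi0_eq)
  ultimately show ?thesis by (rule iffD2[OF isCont_cong, rotated])
qed

lemma isCont_phi1: "isCont \<phi>\<^sub>1 \<beta>" if "0 < \<beta>"
proof -
  have "isCont (\<lambda>\<beta>. \<beta> * (1 - \<delta> \<beta>) / (1 - \<gamma> \<beta>)) \<beta>"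
    using gamma_less_1[OF that] isCont_gamma[OF that] isCont_delta[OF that]
    by (intro continuous_intros) auto
  moreover have "\<forall>\<^sub>F \<beta> in nhds \<beta>. \<phi>\<^sub>1 \<beta> = \<beta> * (1 - \<delta> \<beta>) / (1 - \<gamma> \<beta>)"
    using eventually_nhds_in_open[of "{0<..}" \<beta>] that by (auto elim!: eventually_mono simp: phi1_eq)
  ultimately show ?thesis by (rule iffD2[OF isCont_cong, rotated])
qed

lemma powr_tendsto_0:
  assumes "\<beta> \<longlonglongrightarrow> 0" "\<And>n. 0 < \<beta> n"
  shows "(\<lambda>n. \<beta> n powr \<rho>) \<longlonglongrightarrow> 0"
  using tendsto_powr2[OF assms(1), of "\<lambda>_. \<rho>" \<rho>] rho_pos assms(2)
  by (auto simp: less_imp_le)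

text \<open>Only the constant terms survive at zero. That \<open>\<gamma>\<close> has the same limit
  makes \<open>\<phi>\<^sub>0\<close> asymptotic to the identity there.\<close>

lemma tendsto_delta:
  assumes "\<beta> \<longlonglongrightarrow> 0" "\<And>n. 0 < \<beta> n"
  shows "(\<lambda>n. \<delta> (\<beta> n)) \<longlonglongrightarrow> (1 + \<kappa>) / 2"
  unfolding delta_fn_def powr_double
  by (rule tendsto_eq_intros powr_tendsto_0[OF assms] refl | simp)+

lemma tendsto_gamma:
  assumes "\<beta> \<longlonglongrightarrow> 0" "\<And>n. 0 < \<beta> n"
  shows "(\<lambda>n. \<gamma> (\<beta> n)) \<longlonglongrightarrow> (1 + \<kappa>) / 2"
  unfolding gamma_fn_def powr_double
  by (rule tendsto_eq_intros powr_tendsto_0[OF assms] refl | simp)+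

text \<open>Intermediate values: \<open>\<phi>\<^sub>0\<close> tends to \<open>0\<close> at
  \<open>0\<close>, and by \<open>phi0_greater\<close> the point \<open>x\<close> itself serves as
  right end.\<close>

lemma phi0_surj:
  assumes "0 < x"
  obtains \<beta> where "0 < \<beta>" "\<phi>\<^sub>0 \<beta> = x"
proof -
  have lim: "(\<lambda>n. inverse (real (Suc n))) \<longlonglongrightarrow> 0"
    by (rule LIMSEQ_inverse_real_of_nat)
  have "(\<lambda>n. inverse (real (Suc n)) * \<delta> (inverse (real (Suc n))) / \<gamma> (inverse (real (Suc n)))) \<longlonglongrightarrow> 0"
    using kappa_pos tendsto_divide[OF tendsto_mult[OF lim tendsto_delta[OF lim]] tendsto_gamma[OF lim]]
    by simp
  then have "(\<lambda>n. \<phi>\<^sub>0 (inverse (real (Suc n)))) \<longlonglongrightarrow> 0"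
    by (simp add: phi0_eq)
  then have "\<forall>\<^sub>F n in sequentially. \<phi>\<^sub>0 (inverse (real (Suc n))) < x"
    using assms by (rule order_tendstoD)
  then obtain n where n: "\<phi>\<^sub>0 (inverse (real (Suc n))) < x"
    using eventually_sequentially by auto
  define l where "l = inverse (real (Suc n))"
  have l: "0 < l" "\<phi>\<^sub>0 l < x" using n by (auto simp: l_def)
  then have "l < x" using phi0_greater[of l] by simp
  obtain \<beta> where "l \<le> \<beta>" "\<phi>\<^sub>0 \<beta> = x"
    using IVT[of \<phi>\<^sub>0 l x x] l \<open>l < x\<close> phi0_greater[OF assms] isCont_phi0 by auto
  then show ?thesis using l(1) by (intro that[of \<beta>]) auto
qed

subsection \<open>The map \<open>s\<close> and its orbits\<close>

abbreviation "beta \<equiv> beta_of \<kappa> \<rho>"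
abbreviation "s \<equiv> s_map \<kappa> \<rho>"

lemma beta_of_phi0: "beta (\<phi>\<^sub>0 \<beta>) = \<beta>" if "0 < \<beta>"
  unfolding beta_of_def
proof (rule the_equality)
  show "z = \<beta>" if "0 < z \<and> \<phi>\<^sub>0 z = \<phi>\<^sub>0 \<beta>" for z
    using that \<open>0 < \<beta>\<close> phi0_less_iff[of z \<beta>] phi0_less_iff[of \<beta> z] by simp
qed (use that in simp)

lemma beta_pos: "0 < beta x" and phi0_beta: "\<phi>\<^sub>0 (beta x) = x" if "0 < x"
  using phi0_surj[OF that] beta_of_phi0 by metis+

lemma s_phi0: "s (\<phi>\<^sub>0 \<beta>) = \<phi>\<^sub>1 \<beta>" if "0 < \<beta>"
  by (simp add: s_map_def beta_of_phi0 that)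

lemma s_pos: "0 < s x" if "0 < x"
  unfolding s_map_def by (simp add: beta_pos phi1_pos that)

text \<open>Injectivity of \<open>\<phi>\<^sub>1\<close> is that of \<open>\<phi>\<^sub>0\<close>
  transported through \<open>phi0_inverse\<close>.\<close>

lemma inj_on_s: "inj_on s {0<..}"
proof (rule inj_onI)
  fix x y :: real
  assume "x \<in> {0<..}" "y \<in> {0<..}" and eq: "s x = s y"
  then have xy: "0 < x" "0 < y" by auto
  have "\<phi>\<^sub>0 (inverse (beta x)) = \<phi>\<^sub>0 (inverse (beta y))"
    using eq xy by (simp add: phi0_inverse beta_pos s_map_def)
  then have "inverse (beta x) = inverse (beta y)"
    using xy beta_pos by (metis beta_of_phi0 inverse_positive_iff_positive)
  then show "x = y"
    using xy by (metis inverse_eq_iff_eq phi0_beta)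
qed

lemma s_image: "s ` {0<..} = {0<..}"
proof safe
  fix y :: real
  assume "0 < y"
  \<comment> \<open>The solution of \<open>\<phi>\<^sub>1 \<beta> = y\<close>: by the symmetry,
    \<open>inverse \<beta>\<close> must solve \<open>\<phi>\<^sub>0 = inverse y\<close>.\<close>
  define \<beta> where "\<beta> = inverse (beta (inverse y))"
  have \<beta>: "0 < \<beta>" using \<open>0 < y\<close> by (simp add: \<beta>_def beta_pos)
  have "s (\<phi>\<^sub>0 \<beta>) = y"
    using \<open>0 < y\<close> by (simp add: s_phi0 \<beta>) (simp add: \<beta>_def phi1_inverse beta_pos phi0_beta)
  then show "y \<in> s ` {0<..}" using phi0_pos[OF \<beta>] by (force intro: image_eqI[of _ _ "\<phi>\<^sub>0 \<beta>"])
qed (simp add: s_pos)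

abbreviation "s_inv \<equiv> inv_into {0<..} s"

lemma s_inv_pos: "0 < s_inv y" and s_s_inv: "s (s_inv y) = y" if "0 < y"
  using that inv_into_into[of y s "{0<..}"] f_inv_into_f[of y s "{0<..}"] by (auto simp: s_image)

lemma funpow_pos:
  fixes f :: "real \<Rightarrow> real"
  assumes "\<And>y. 0 < y \<Longrightarrow> 0 < f y" "0 < x"
  shows "0 < (f ^^ k) x"
  using assms by (induction k) simp_all

lemma s_iter_pos: "0 < s_iter \<kappa> \<rho> i x" if "0 < x"
  unfolding s_iter_def using funpow_pos[OF s_pos that] funpow_pos[OF s_inv_pos that] by auto

lemma s_iter_0: "s_iter \<kappa> \<rho> 0 x = x"
  by (simp add: s_iter_def)

lemma s_iter_Suc: "s_iter \<kappa> \<rho> (i + 1) x = s (s_iter \<kappa> \<rho> i x)" if "0 < x"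
proof (cases "0 \<le> i")
  case True
  then have "nat (i + 1) = Suc (nat i)" by simp
  then show ?thesis using True by (simp add: s_iter_def)
next
  case False
  \<comment> \<open>The number of inverse steps left after \<open>s\<close> cancels the outermost
    one.\<close>
  define k where "k = nat (- i - 1)"
  have "nat (- i) = Suc k" using False by (simp add: k_def)
  then have "s (s_iter \<kappa> \<rho> i x) = (s_inv ^^ k) x"
    using False s_s_inv[OF funpow_pos[OF s_inv_pos that]] by (simp add: s_iter_def)
  moreover have "s_iter \<kappa> \<rho> (i + 1) x = (s_inv ^^ k) x"
  \<comment> \<open>At \<open>i = -1\<close> the successor falls into the forward branch of
    \<open>s_iter\<close>, where it is the identity.\<close>
  proof (cases "i = -1")
    case True
    then show ?thesis by (simp add: s_iter_def k_def)
  next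
    case neq: False
    then show ?thesis using False by (simp add: s_iter_def k_def)
  qed
  ultimately show ?thesis by simp
qed

text \<open>Upward the recursion determines the next term; downward the injectivity of
  \<open>s\<close> does.\<close>

lemma s_iter_unique:
  assumes "\<And>i. 0 < X i" "\<And>i. X (i + 1) = s (X i)"
  shows "X i = s_iter \<kappa> \<rho> i (X 0)"
proof (induction i rule: int_induct[where k = 0])
  case base
  then show ?case by (simp add: s_iter_0)
next
  case (step1 i)
  then show ?case using assms by (simp add: s_iter_Suc)
next
  case (step2 i)
  have "s (X (i - 1)) = s (s_iter \<kappa> \<rho> (i - 1) (X 0))"
    using step2 assms(2)[of "i - 1"] s_iter_Suc[of "X 0" "i - 1"] assms(1) by simp
  then show ?case
    using inj_on_s assms(1) s_iter_pos by (auto dest!: inj_onD)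
qed

text \<open>Since \<open>\<phi>\<^sub>1\<close> lies below and \<open>\<phi>\<^sub>0\<close> above
  the identity, the sequence decreases. By continuity a positive limit would be a point where
  \<open>\<phi>\<^sub>0\<close> and \<open>\<phi>\<^sub>1\<close> agree.\<close>

lemma phi_recursion_tendsto_0:
  assumes pos: "\<And>n. 0 < \<beta> n" and rec: "\<And>n. \<phi>\<^sub>0 (\<beta> (Suc n)) = \<phi>\<^sub>1 (\<beta> n)"
  shows "\<beta> \<longlonglongrightarrow> 0"
proof -
  have "\<phi>\<^sub>0 (\<beta> (Suc n)) < \<phi>\<^sub>0 (\<beta> n)" for n
    unfolding rec using phi1_less[OF pos[of n]] phi0_greater[OF pos[of n]] by simp
  then have "decseq \<beta>"
    using pos phi0_less_iff by (auto intro!: decseq_SucI less_imp_le)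
  then obtain L where L: "\<beta> \<longlonglongrightarrow> L"
    using decseq_convergent[of \<beta> 0] pos by (meson less_imp_le)
  have "L \<ge> 0" using L pos by (intro LIMSEQ_le_const[OF L]) (auto simp: less_imp_le)
  moreover have False if "0 < L"
  proof -
    have "(\<lambda>n. \<phi>\<^sub>0 (\<beta> (Suc n))) \<longlonglongrightarrow> \<phi>\<^sub>0 L"
      using isCont_tendsto_compose[OF isCont_phi0[OF that] LIMSEQ_Suc[OF L]] .
    moreover have "(\<lambda>n. \<phi>\<^sub>0 (\<beta> (Suc n))) \<longlonglongrightarrow> \<phi>\<^sub>1 L"
      unfolding rec using isCont_tendsto_compose[OF isCont_phi1[OF that] L] .
    ultimately have "\<phi>\<^sub>0 L = \<phi>\<^sub>1 L" by (rule LIMSEQ_unique)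
    then show False using phi0_greater[OF that] phi1_less[OF that] by simp
  qed
  ultimately show ?thesis using L by (cases "L = 0") auto
qed

end

section \<open>Antidifferences of sequences indexed by the integers\<close>

lemma int_tendsto_at_top:
  fixes f :: "int \<Rightarrow> real"
  assumes "(\<lambda>k. f (int k)) \<longlonglongrightarrow> l"
  shows "(f \<longlongrightarrow> l) at_top"
proof -
  have "filterlim nat at_top (at_top :: int filter)"
    by (rule filterlim_nat_sequentially)
  then have "((\<lambda>i. f (int (nat i))) \<longlongrightarrow> l) at_top"
    using assms by (rule filterlim_compose[rotated])
  moreover have "\<forall>\<^sub>F i in at_top. f (int (nat i)) = f i"
    using eventually_ge_at_top[of 0] by eventually_elim simp
  ultimately show ?thesis
    by (rule Lim_transform_eventually)
qed

lemma at_top_int_sequence: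
  fixes f :: "int \<Rightarrow> real"
  assumes "(f \<longlongrightarrow> l) at_top"
  shows "(\<lambda>k. f (int k)) \<longlonglongrightarrow> l"
  using filterlim_compose[OF assms filterlim_int_sequentially] .

lemma at_bot_int_mirror:
  fixes f :: "int \<Rightarrow> real"
  shows "(f \<longlongrightarrow> l) at_bot \<longleftrightarrow> ((\<lambda>i. f (- i)) \<longlongrightarrow> l) at_top"
  by (simp add: at_bot_mirror filterlim_filtermap)

lemma int_constant:
  fixes f :: "int \<Rightarrow> real"
  assumes "\<And>k. f (k + 1) = f k"
  shows "f k = f 0"
proof (induction k rule: int_induct[where k = 0])
  case (step2 k)
  then show ?case using assms[of "k - 1"] by simp
qed (simp_all only: assms)

text \<open>The solution is the tail sum of \<open>D\<close> from \<open>k\<close> on; the ratio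
  test makes it converge.\<close>

lemma antidifference_exists:
  fixes D :: "int \<Rightarrow> real"
  assumes pos: "\<And>k. 0 < D k" and lim: "(\<lambda>k. D (int k + 1) / D (int k)) \<longlonglongrightarrow> r" and "r < 1"
  shows "\<exists>n. (n \<longlongrightarrow> 0) at_top \<and> (\<forall>k. n k - n (k + 1) = D k)"
proof -
  obtain q where q: "r < q" "q < 1"
    using dense[OF \<open>r < 1\<close>] by blast
  obtain K where K: "\<And>k. K \<le> k \<Longrightarrow> D (int k + 1) / D (int k) < q"
    using order_tendstoD(2)[OF lim q(1)] unfolding eventually_sequentially by blast
  have "summable (\<lambda>j. D (int j))"
  proof (rule summable_ratio_test[OF q(2), where N = K])
    fix k
    assume "K \<le> k"
    then show "norm (D (int (Suc k))) \<le> q * norm (D (int k))"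
      using K[of k] pos[of "int k"] pos[of "int k + 1"] by (simp add: field_simps)
  qed
  \<comment> \<open>The tail sum: from the total over nonnegative indices, the terms before
    \<open>k\<close> are removed, or for negative \<open>k\<close> the finite block from
    \<open>k\<close> to \<open>-1\<close> is added.\<close>
  define n where "n = (\<lambda>k. (\<Sum>j. D (int j)) - (if 0 \<le> k then \<Sum>j<nat k. D (int j) else - (\<Sum>j\<in>{k..<0}. D j)))"
  have "n k - n (k + 1) = D k" for k
  proof (cases "0 \<le> k")
    case True
    then have "nat (k + 1) = Suc (nat k)" by simp
    then show ?thesis using True by (simp add: n_def)
  next
    case False
    have "{k..<0} = insert k {k + 1..<0}" using False by auto
    then have "(\<Sum>j\<in>{k..<0}. D j) = D k + (\<Sum>j\<in>{k+1..<0}. D j)" by simp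
    \<comment> \<open>For \<open>k = -1\<close> the value at \<open>k + 1\<close> comes from the
      other branch, with an empty sum.\<close>
    then show ?thesis using False by (cases "k = -1") (auto simp: n_def)
  qed
  moreover have "(n \<longlongrightarrow> 0) at_top"
  proof (rule int_tendsto_at_top)
    have "(\<lambda>k. (\<Sum>j. D (int j)) - (\<Sum>j<k. D (int j))) \<longlonglongrightarrow> (\<Sum>j. D (int j)) - (\<Sum>j. D (int j))"
      by (intro tendsto_intros summable_LIMSEQ \<open>summable (\<lambda>j. D (int j))\<close>)
    then show "(\<lambda>k. n (int k)) \<longlonglongrightarrow> 0" by (simp add: n_def)
  qed
  ultimately show ?thesis by blast
qed

text \<open>Two solutions differ by a constant, and the limit makes it zero.\<close>

lemma antidifference_unique:
  fixes n n' D :: "int \<Rightarrow> real"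
  assumes "(n \<longlongrightarrow> 0) at_top" "\<forall>k. n k - n (k + 1) = D k"
    and "(n' \<longlongrightarrow> 0) at_top" "\<forall>k. n' k - n' (k + 1) = D k"
  shows "n = n'"
proof
  fix k
  define f where "f = (\<lambda>k. n k - n' k)"
  have "f (k + 1) = f k" for k
    using assms(2)[rule_format, of k] assms(4)[rule_format, of k] by (simp add: f_def)
  then have f: "f k = f 0" for k by (rule int_constant)
  have "(f \<longlongrightarrow> 0) at_top"
    unfolding f_def using tendsto_diff[OF assms(1,3)] by simp
  then have "(\<lambda>k. f (int k)) \<longlonglongrightarrow> 0" by (rule at_top_int_sequence)
  moreover have "(\<lambda>k. f (int k)) = (\<lambda>_. f 0)"
    using f by blast
  ultimately have "f 0 = 0"
    by (simp add: LIMSEQ_const_iff)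
  then show "n k = n' k" using f[of k] by (simp add: f_def)
qed

text \<open>Reflection \<open>k \<mapsto> - k\<close> turns a condition at \<open>-\<infinity>\<close> on forward differences into one at
  \<open>\<infinity>\<close> on backward differences; the index shift \<open>- k - 1\<close> accounts for the change of direction.\<close>

lemma forward_difference_mirror:
  fixes m D :: "int \<Rightarrow> real"
  shows "(m \<longlongrightarrow> 0) at_bot \<and> (\<forall>k. m (k + 1) - m k = D k) \<longleftrightarrow>
    ((\<lambda>k. m (- k)) \<longlongrightarrow> 0) at_top \<and> (\<forall>k. m (- k) - m (- (k + 1)) = D (- k - 1))"
proof -
  have e: "- (k + 1) = - k - 1" for k :: int by simp
  have "(\<forall>k. m (k + 1) - m k = D k) \<longleftrightarrow> (\<forall>k. m (- k) - m (- (k + 1)) = D (- k - 1))"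
  proof safe
    fix k
    assume "\<forall>k. m (k + 1) - m k = D k"
    from this[rule_format, of "- k - 1"] show "m (- k) - m (- (k + 1)) = D (- k - 1)"
      unfolding e by simp
  next
    fix k
    assume "\<forall>k. m (- k) - m (- (k + 1)) = D (- k - 1)"
    from this[rule_format, of "- k - 1"] show "m (k + 1) - m k = D k"
      by (simp add: add.commute)
  qed
  then show ?thesis by (simp add: at_bot_int_mirror)
qed

text \<open>The hypothesis on ratios is the one of \<open>antidifference_exists\<close> for the
  reflected sequence \<open>D (- k - 1)\<close>.\<close>

lemma forward_antidifference_exists:
  fixes D :: "int \<Rightarrow> real"
  assumes pos: "\<And>k. 0 < D k" and lim: "(\<lambda>k. D (- int k - 2) / D (- int k - 1)) \<longlonglongrightarrow> r" and "r < 1"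
  shows "\<exists>m. (m \<longlongrightarrow> 0) at_bot \<and> (\<forall>k. m (k + 1) - m k = D k)"
proof -
  have e: "- (int k + 1) - 1 = - int k - 2" for k by simp
  have "(\<lambda>k. D (- (int k + 1) - 1) / D (- int k - 1)) \<longlonglongrightarrow> r"
    unfolding e by (rule lim)
  then obtain n where "(n \<longlongrightarrow> 0) at_top" "\<forall>k. n k - n (k + 1) = D (- k - 1)"
    using antidifference_exists[of "\<lambda>k. D (- k - 1)" r, OF pos _ \<open>r < 1\<close>] by blast
  then show ?thesis
    using forward_difference_mirror[of "\<lambda>k. n (- k)" D] by (intro exI[of _ "\<lambda>k. n (- k)"]) (simp add: add.commute)
qed

lemma forward_antidifference_unique:
  fixes m m' D :: "int \<Rightarrow> real"
  assumes "(m \<longlongrightarrow> 0) at_bot" "\<forall>k. m (k + 1) - m k = D k"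
    and "(m' \<longlongrightarrow> 0) at_bot" "\<forall>k. m' (k + 1) - m' k = D k"
  shows "m = m'"
proof -
  have "(\<lambda>k. m (- k)) = (\<lambda>k. m' (- k))"
    using forward_difference_mirror[of m D] forward_difference_mirror[of m' D] assms
    by (intro antidifference_unique[where D = "\<lambda>k. D (- k - 1)"]) auto
  then show ?thesis by (metis ext minus_minus)
qed

section \<open>Products from zero to an arbitrary integer\<close>

lemma prod_to_minus_1: "prod_to h (- 1) = 1"
  by (simp add: prod_to_def)

text \<open>For negative \<open>k\<close> the step removes a factor
  \<open>inverse (h (k + 1))\<close>, so \<open>h\<close> must not vanish; at \<open>k = -1\<close>
  it passes from one branch of \<open>prod_to\<close> to the other.\<close>

lemma prod_to_Suc:
  assumes "\<And>i. h i \<noteq> 0"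
  shows "prod_to h (k + 1) = prod_to h k * h (k + 1)"
proof (cases "0 \<le> k")
  case True
  then have "{0..k + 1} = insert (k + 1) {0..k}" by auto
  then show ?thesis using True by (simp add: prod_to_def mult.commute)
next
  case False
  show ?thesis
  proof (cases "k = -1")
    case True
    then show ?thesis by (simp add: prod_to_def)
  next
    case neq: False
    then have "{k + 1..-1} = insert (k + 1) {k + 2..-1}" using False by auto
    then have "prod_to h k = inverse (h (k + 1)) * (\<Prod>i\<in>{k + 2..-1}. inverse (h i))"
      using False by (simp add: prod_to_def)
    moreover have "prod_to h (k + 1) = (\<Prod>i\<in>{k + 2..-1}. inverse (h i))"
      using False neq by (simp add: prod_to_def add.commute)
    ultimately show ?thesis using assms[of "k + 1"] by simp
  qed
qed

lemma prod_to_pos: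
  assumes "\<And>i. 0 < h i"
  shows "0 < prod_to h k"
  unfolding prod_to_def by (simp add: assms prod_pos)

text \<open>The induction starts at \<open>-1\<close>, the index of the empty product.\<close>

lemma prod_to_unique:
  assumes "\<And>i. h i \<noteq> 0" "\<And>k. f (k + 1) = f k * h (k + 1)"
  shows "f k = f (- 1) * prod_to h k"
proof (induction k rule: int_induct[where k = "- 1"])
  case base
  show ?case by (simp add: prod_to_minus_1)
next
  case (step1 k)
  then show ?case by (simp add: assms prod_to_Suc)
next
  case (step2 k)
  then show ?case
    using assms(2)[of "k - 1"] prod_to_Suc[of h "k - 1"] assms(1)[of k] assms(1) by simp
qed

section \<open>The default sequences\<close>

context weights
begin

lemma c_fn_phi0: "c_fn \<kappa> \<rho> (\<phi>\<^sub>0 \<beta>) = 1 / \<gamma> \<beta>" and d_fn_phi0: "d_fn \<kappa> \<rho> (\<phi>\<^sub>0 \<beta>) = 1 / \<delta> \<beta>"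
  if "0 < \<beta>"
  by (simp_all add: c_fn_def d_fn_def beta_of_phi0 that)

lemma c_fn_greater_1: "1 < c_fn \<kappa> \<rho> x" and d_fn_greater_1: "1 < d_fn \<kappa> \<rho> x" if "0 < x"
  unfolding c_fn_def d_fn_def using beta_pos[OF that] gamma_pos gamma_less_1 delta_pos delta_less_1
  by simp_all

text \<open>With \<open>c - 1 = (1 - \<gamma>) / \<gamma>\<close> and
  \<open>d - 1 = (1 - \<delta>) / \<delta>\<close>, the right side turns
  \<open>\<beta> * \<delta> / \<gamma>\<close> into
  \<open>\<beta> * (1 - \<delta>) / (1 - \<gamma>)\<close>. This ties the orbit of \<open>s\<close>
  to the products in the default sequences.\<close>

lemma s_map_ratio: "s x = x * (d_fn \<kappa> \<rho> x - 1) / (c_fn \<kappa> \<rho> x - 1)" if "0 < x"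
proof -
  define \<beta> where "\<beta> = beta x"
  have \<beta>: "0 < \<beta>" and x: "x = \<phi>\<^sub>0 \<beta>"
    using beta_pos[OF that] phi0_beta[OF that] by (auto simp: \<beta>_def)
  show ?thesis
    unfolding x s_phi0[OF \<beta>] c_fn_phi0[OF \<beta>] d_fn_phi0[OF \<beta>]
    unfolding phi0_eq[OF \<beta>] phi1_eq[OF \<beta>]
    using \<beta> gamma_pos[OF \<beta>] gamma_less_1[OF \<beta>] delta_pos[OF \<beta>] by (simp add: divide_simps)
qed

abbreviation "S x i \<equiv> s_iter \<kappa> \<rho> i x"

lemma beta_recursion: "\<phi>\<^sub>0 (beta (S x (i + 1))) = \<phi>\<^sub>1 (beta (S x i))" if "0 < x"
  using that by (simp add: phi0_beta s_iter_pos s_iter_Suc s_pos) (simp add: s_map_def)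

lemma beta_forward_tendsto_0: "(\<lambda>n. beta (S x (int n))) \<longlonglongrightarrow> 0" if "0 < x"
  using that beta_recursion[of x "int _"]
  by (intro phi_recursion_tendsto_0) (auto simp: beta_pos s_iter_pos add.commute[of 1])

text \<open>Inverting both sides of \<open>beta_recursion\<close> swaps
  \<open>\<phi>\<^sub>0\<close> and \<open>\<phi>\<^sub>1\<close> and so reverses its
  direction.\<close>

lemma beta_backward_tendsto_0: "(\<lambda>n. inverse (beta (S x (- int n)))) \<longlonglongrightarrow> 0" if "0 < x"
proof (rule phi_recursion_tendsto_0)
  fix n
  have "\<phi>\<^sub>0 (beta (S x (- int n))) = \<phi>\<^sub>1 (beta (S x (- int (Suc n))))"
    using beta_recursion[OF that, of "- int (Suc n)"] by simp
  then show "\<phi>\<^sub>0 (inverse (beta (S x (- int (Suc n))))) = \<phi>\<^sub>1 (inverse (beta (S x (- int n))))"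
    using that by (simp only: phi0_inverse phi1_inverse beta_pos s_iter_pos)
qed (simp add: that beta_pos s_iter_pos)

text \<open>One limit serves both ends: the quotient is \<open>d - 1\<close> along the forward orbit
  and \<open>1 / (c - 1)\<close> along the inverted backward orbit.\<close>

lemma ratio_tendsto:
  assumes "\<beta> \<longlonglongrightarrow> 0" "\<And>n. 0 < \<beta> n"
  shows "(\<lambda>n. (1 - \<delta> (\<beta> n)) / \<delta> (\<beta> n)) \<longlonglongrightarrow> (1 - \<kappa>) / (1 + \<kappa>)"
proof -
  have "(\<lambda>n. (1 - \<delta> (\<beta> n)) / \<delta> (\<beta> n)) \<longlonglongrightarrow> (1 - (1 + \<kappa>) / 2) / ((1 + \<kappa>) / 2)"
    using kappa_pos by (intro tendsto_intros tendsto_delta[OF assms]) auto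
  also have "(1 - (1 + \<kappa>) / 2) / ((1 + \<kappa>) / 2) = (1 - \<kappa>) / (1 + \<kappa>)"
    using kappa_pos by (simp add: field_simps)
  finally show ?thesis .
qed

lemma ratio_less_1: "(1 - \<kappa>) / (1 + \<kappa>) < 1"
  using kappa_pos by simp

definition m_diff :: "real \<Rightarrow> int \<Rightarrow> real" where
  "m_diff x k = \<kappa> * prod_to (\<lambda>i. c_iter \<kappa> \<rho> i x - 1) k"

definition n_diff :: "real \<Rightarrow> int \<Rightarrow> real" where
  "n_diff x k = \<kappa> * x * prod_to (\<lambda>i. d_iter \<kappa> \<rho> i x - 1) k"

lemma c_iter_greater_1: "1 < c_iter \<kappa> \<rho> i x" and d_iter_greater_1: "1 < d_iter \<kappa> \<rho> i x" if "0 < x"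
  using that by (simp_all add: c_iter_def d_iter_def c_fn_greater_1 d_fn_greater_1 s_iter_pos)

lemma m_diff_pos: "0 < m_diff x k" and n_diff_pos: "0 < n_diff x k" if "0 < x"
  unfolding m_diff_def n_diff_def using that kappa_pos c_iter_greater_1[OF that] d_iter_greater_1[OF that]
  by (intro mult_pos_pos prod_to_pos; simp)+

lemma m_diff_Suc: "m_diff x (k + 1) = m_diff x k * (c_iter \<kappa> \<rho> (k + 1) x - 1)"
  and n_diff_Suc: "n_diff x (k + 1) = n_diff x k * (d_iter \<kappa> \<rho> (k + 1) x - 1)" if "0 < x"
proof -
  have "c_iter \<kappa> \<rho> i x - 1 \<noteq> 0" "d_iter \<kappa> \<rho> i x - 1 \<noteq> 0" for i
    using c_iter_greater_1[OF that, of i] d_iter_greater_1[OF that, of i] by simp_all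
  then show "m_diff x (k + 1) = m_diff x k * (c_iter \<kappa> \<rho> (k + 1) x - 1)"
    "n_diff x (k + 1) = n_diff x k * (d_iter \<kappa> \<rho> (k + 1) x - 1)"
    by (simp_all add: m_diff_def n_diff_def prod_to_Suc)
qed

text \<open>Shows that the definite description denotes: geometric decay towards
  \<open>-\<infinity>\<close> gives existence, the zero limit uniqueness.\<close>

lemma m_def_seq_properties:
  assumes "0 < x"
  shows "(m_def_seq \<kappa> \<rho> x \<longlongrightarrow> 0) at_bot \<and> (\<forall>k. m_def_seq \<kappa> \<rho> x (k + 1) - m_def_seq \<kappa> \<rho> x k = m_diff x k)"
proof -
  \<comment> \<open>Index \<open>- n - 1\<close>, because \<open>c\<close> at that index relates the
    differences at \<open>- n - 2\<close> and \<open>- n - 1\<close>.\<close>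
  define \<beta> where "\<beta> = (\<lambda>n. inverse (beta (S x (- int (Suc n)))))"
  have "m_diff x (- int n - 2) / m_diff x (- int n - 1) = (1 - \<delta> (\<beta> n)) / \<delta> (\<beta> n)" for n
  proof -
    have e: "- int n - 2 + 1 = - int n - 1" "- int (Suc n) = - int n - 1" by simp_all
    have "m_diff x (- int n - 1) = m_diff x (- int n - 2) * (c_iter \<kappa> \<rho> (- int n - 1) x - 1)"
      using m_diff_Suc[OF assms, of "- int n - 2"] unfolding e .
    then have "m_diff x (- int n - 2) / m_diff x (- int n - 1) = 1 / (c_iter \<kappa> \<rho> (- int n - 1) x - 1)"
      using m_diff_pos[OF assms, of "- int n - 2"] by simp
    also have "\<dots> = 1 / (1 / \<gamma> (inverse (\<beta> n)) - 1)"
      unfolding \<beta>_def e by (simp add: c_iter_def c_fn_def)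
    also have "\<dots> = (1 - \<delta> (\<beta> n)) / \<delta> (\<beta> n)"
    proof -
      have "0 < \<beta> n" by (simp add: \<beta>_def beta_pos s_iter_pos assms)
      then show ?thesis
        using delta_less_1[of "\<beta> n"] delta_pos[of "\<beta> n"] unfolding gamma_inverse[OF \<open>0 < \<beta> n\<close>]
        by (simp add: divide_simps)
    qed
    finally show ?thesis .
  qed
  moreover have "(\<lambda>n. (1 - \<delta> (\<beta> n)) / \<delta> (\<beta> n)) \<longlonglongrightarrow> (1 - \<kappa>) / (1 + \<kappa>)"
    unfolding \<beta>_def by (intro ratio_tendsto LIMSEQ_Suc[OF beta_backward_tendsto_0[OF assms]])
      (simp add: beta_pos s_iter_pos assms)
  ultimately obtain m where m: "(m \<longlongrightarrow> 0) at_bot" "\<forall>k. m (k + 1) - m k = m_diff x k"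
    using forward_antidifference_exists[of "m_diff x", OF m_diff_pos[OF assms] _ ratio_less_1] by auto
  then have "m_def_seq \<kappa> \<rho> x = m"
    unfolding m_def_seq_def m_diff_def[symmetric]
    by (intro the_equality) (auto intro: forward_antidifference_unique)
  with m show ?thesis by simp
qed

lemma n_def_seq_properties:
  assumes "0 < x"
  shows "(n_def_seq \<kappa> \<rho> x \<longlongrightarrow> 0) at_top \<and> (\<forall>k. n_def_seq \<kappa> \<rho> x k - n_def_seq \<kappa> \<rho> x (k + 1) = n_diff x k)"
proof -
  define \<beta> where "\<beta> = (\<lambda>n. beta (S x (int (Suc n))))"
  have "n_diff x (int n + 1) / n_diff x (int n) = (1 - \<delta> (\<beta> n)) / \<delta> (\<beta> n)" for n
  proof -
    have "n_diff x (int n + 1) / n_diff x (int n) = d_iter \<kappa> \<rho> (int n + 1) x - 1"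
      using n_diff_Suc[OF assms, of "int n"] n_diff_pos[OF assms, of "int n"] by simp
    also have "\<dots> = 1 / \<delta> (\<beta> n) - 1"
      by (simp add: d_iter_def d_fn_def \<beta>_def add.commute)
    also have "\<dots> = (1 - \<delta> (\<beta> n)) / \<delta> (\<beta> n)"
      using delta_pos[of "\<beta> n"] by (simp add: \<beta>_def beta_pos s_iter_pos assms divide_simps)
    finally show ?thesis .
  qed
  moreover have "(\<lambda>n. (1 - \<delta> (\<beta> n)) / \<delta> (\<beta> n)) \<longlonglongrightarrow> (1 - \<kappa>) / (1 + \<kappa>)"
    unfolding \<beta>_def by (intro ratio_tendsto LIMSEQ_Suc[OF beta_forward_tendsto_0[OF assms]])
      (simp add: beta_pos s_iter_pos assms)
  ultimately obtain n where n: "(n \<longlongrightarrow> 0) at_top" "\<forall>k. n k - n (k + 1) = n_diff x k"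
    using antidifference_exists[of "n_diff x", OF n_diff_pos[OF assms] _ ratio_less_1] by auto
  then have "n_def_seq \<kappa> \<rho> x = n"
    unfolding n_def_seq_def n_diff_def[symmetric]
    by (intro the_equality) (auto intro: antidifference_unique)
  with n show ?thesis by simp
qed

text \<open>By \<open>s_map_ratio\<close> both sides are multiplied by
  \<open>(d - 1) / (c - 1)\<close> at each step, and both equal \<open>x\<close> at
  \<open>k = -1\<close>. The shift by one arises because the difference with index \<open>k\<close>
  joins \<open>k\<close> and \<open>k + 1\<close>.\<close>

lemma diff_ratio: "n_diff x k / m_diff x k = S x (k + 1)" if "0 < x"
proof -
  define h where "h = (\<lambda>i. (d_iter \<kappa> \<rho> i x - 1) / (c_iter \<kappa> \<rho> i x - 1))"
  have h: "h i \<noteq> 0" for i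
    using c_iter_greater_1[OF that, of i] d_iter_greater_1[OF that, of i] by (simp add: h_def)
  have "n_diff x (k + 1) / m_diff x (k + 1) = n_diff x k / m_diff x k * h (k + 1)" for k
    unfolding n_diff_Suc[OF that] m_diff_Suc[OF that] h_def by simp
  then have "n_diff x k / m_diff x k = n_diff x (- 1) / m_diff x (- 1) * prod_to h k"
    by (intro prod_to_unique[where f = "\<lambda>k. n_diff x k / m_diff x k"] h)
  moreover have "S x (k + 1 + 1) = S x (k + 1) * h (k + 1)" for k
    using s_iter_Suc[OF that, of "k + 1"] s_map_ratio[OF s_iter_pos[OF that], of "k + 1"]
    unfolding h_def c_iter_def d_iter_def by simp
  then have "S x (k + 1) = S x (- 1 + 1) * prod_to h k"
    by (intro prod_to_unique[where f = "\<lambda>k. S x (k + 1)"] h)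
  moreover have "n_diff x (- 1) / m_diff x (- 1) = S x (- 1 + 1)"
    using kappa_pos by (simp add: n_diff_def m_diff_def prod_to_minus_1 s_iter_0)
  ultimately show ?thesis by simp
qed

subsection \<open>The equations in terms of differences\<close>

text \<open>The factor common to both default formulas: they read \<open>M * weight M N\<close> and
  \<open>N * weight M N\<close>. It is homogeneous of degree zero.\<close>

definition weight :: "real \<Rightarrow> real \<Rightarrow> real" where
  "weight M N = \<kappa> * \<rho> * M powr \<rho> * N powr \<rho> / (M powr \<rho> + N powr \<rho>)\<^sup>2"

lemma weight_scale: "weight (\<mu> * M) (\<mu> * N) = weight M N" if "0 < \<mu>" "0 < M" "0 < N"
proof -
  have "(\<mu> powr \<rho> * M powr \<rho> + \<mu> powr \<rho> * N powr \<rho>)\<^sup>2 = (\<mu> powr \<rho>)\<^sup>2 * (M powr \<rho> + N powr \<rho>)\<^sup>2"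
    by algebra
  then show ?thesis
    using that by (simp add: weight_def powr_mult power2_eq_square)
qed

lemma weight_pos: "0 < weight M N" if "0 < M" "0 < N"
  unfolding weight_def using that kappa_pos rho_pos
  by (intro divide_pos_pos mult_pos_pos zero_less_power add_pos_pos; simp)

text \<open>The equation is linear in \<open>m\<close>. Once \<open>a\<close> is eliminated through
  its own equation, the coefficient of \<open>M\<close> is a quadratic form in \<open>A\<close> and
  \<open>B\<close>, which is the numerator of \<open>\<gamma>\<close> because
  \<open>(b / a) powr \<rho> = B / A\<close>.\<close>

lemma weighted_step_iff:
  assumes "0 < A" "0 < B" and a: "a * (A + B)\<^sup>2 = \<rho> * \<kappa> * A * B * M"
    and A: "A = a powr \<rho>" and B: "B = b powr \<rho>" and "0 < a" "0 < b"
  shows "2 * (A + B) * (m + a) = (A * (1 - \<kappa>) + B * (1 + \<kappa>)) * m' + (A * (1 + \<kappa>) + B * (1 - \<kappa>)) * (m' + M)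
    \<longleftrightarrow> m - m' = M * \<gamma> (b / a)"
proof -
  have p: "(b / a) powr \<rho> = B / A" using assms by (simp add: powr_divide)
  have "A + B > 0" using assms(1,2) by (rule add_pos_pos)
  have \<gamma>: "2 * (A + B)\<^sup>2 * \<gamma> (b / a) = (1 - \<kappa>) * B\<^sup>2 + 2 * (1 - \<rho> * \<kappa>) * A * B + (1 + \<kappa>) * A\<^sup>2"
  proof -
    have "1 + B / A = (A + B) / A" using \<open>0 < A\<close> by (simp add: field_simps)
    then show ?thesis
      unfolding gamma_fn_def powr_double p using \<open>A + B > 0\<close> \<open>0 < A\<close>
      by (simp add: power_divide) (simp add: field_simps power2_eq_square)
  qed
  have "2 * (A + B) * (m + a) = (A * (1 - \<kappa>) + B * (1 + \<kappa>)) * m' + (A * (1 + \<kappa>) + B * (1 - \<kappa>)) * (m' + M)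
    \<longleftrightarrow> 2 * (A + B) * (m - m') = (A * (1 + \<kappa>) + B * (1 - \<kappa>)) * M - 2 * (A + B) * a"
    by (simp add: algebra_simps)
  \<comment> \<open>A further factor \<open>A + B\<close> produces
    \<open>a * (A + B)\<^sup>2\<close>, to which the hypothesis on \<open>a\<close> applies.\<close>
  also have "\<dots> \<longleftrightarrow> (A + B) * (2 * (A + B) * (m - m')) = (A + B) * ((A * (1 + \<kappa>) + B * (1 - \<kappa>)) * M - 2 * (A + B) * a)"
    using \<open>A + B > 0\<close> by simp
  also have "(A + B) * ((A * (1 + \<kappa>) + B * (1 - \<kappa>)) * M - 2 * (A + B) * a) =
      (A + B) * (A * (1 + \<kappa>) + B * (1 - \<kappa>)) * M - 2 * (a * (A + B)\<^sup>2)"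
    by (simp add: algebra_simps power2_eq_square)
  also have "\<dots> = 2 * (A + B)\<^sup>2 * (M * \<gamma> (b / a))"
  proof -
    have "2 * (A + B)\<^sup>2 * (M * \<gamma> (b / a)) = M * ((1 - \<kappa>) * B\<^sup>2 + 2 * (1 - \<rho> * \<kappa>) * A * B + (1 + \<kappa>) * A\<^sup>2)"
      using \<gamma> by (metis mult.assoc mult.commute)
    then show ?thesis unfolding a by (simp add: algebra_simps power2_eq_square)
  qed
  also have "(A + B) * (2 * (A + B) * (m - m')) = 2 * (A + B)\<^sup>2 * (m - m')"
    by (simp add: power2_eq_square)
  finally show ?thesis using \<open>A + B > 0\<close> by simp
qed

text \<open>Makes the implicit equations explicit: \<open>(a, b)\<close> is a positive multiple of
  \<open>(M, N)\<close>, so the two weights agree by homogeneity.\<close>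

lemma weight_fixpoint_iff:
  assumes "0 < a" "0 < b"
  shows "a = M * weight a b \<and> b = N * weight a b \<longleftrightarrow>
    0 < M \<and> 0 < N \<and> a = M * weight M N \<and> b = N * weight M N"
proof
  assume *: "a = M * weight a b \<and> b = N * weight a b"
  have w: "0 < weight a b" using assms by (rule weight_pos)
  then have "0 < M" "0 < N"
    using * assms by (metis zero_less_mult_pos2)+
  moreover have "weight a b = weight M N"
    using * weight_scale[OF w \<open>0 < M\<close> \<open>0 < N\<close>] by (metis mult.commute)
  ultimately show "0 < M \<and> 0 < N \<and> a = M * weight M N \<and> b = N * weight M N"
    using * by simp
next
  assume *: "0 < M \<and> 0 < N \<and> a = M * weight M N \<and> b = N * weight M N"
  then have "weight a b = weight M N"
    using weight_scale[of "weight M N" M N] weight_pos by (metis mult.commute)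
  then show "a = M * weight a b \<and> b = N * weight a b"
    using * by simp
qed

lemma difference_equation_iff:
  assumes "0 < a" "0 < b"
  shows "(a powr \<rho> + b powr \<rho>)\<^sup>2 = \<rho> * \<kappa> * a powr (\<rho> - 1) * b powr \<rho> * M \<longleftrightarrow> a = M * weight a b"
    and "(a powr \<rho> + b powr \<rho>)\<^sup>2 = \<rho> * \<kappa> * a powr \<rho> * b powr (\<rho> - 1) * N \<longleftrightarrow> b = N * weight a b"
proof -
  have pos: "0 < a powr \<rho>" "0 < b powr \<rho>" using assms by simp_all
  then have "0 < (a powr \<rho> + b powr \<rho>)\<^sup>2" by (intro zero_less_power add_pos_pos)
  with assms pos show
    "(a powr \<rho> + b powr \<rho>)\<^sup>2 = \<rho> * \<kappa> * a powr (\<rho> - 1) * b powr \<rho> * M \<longleftrightarrow> a = M * weight a b"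
    "(a powr \<rho> + b powr \<rho>)\<^sup>2 = \<rho> * \<kappa> * a powr \<rho> * b powr (\<rho> - 1) * N \<longleftrightarrow> b = N * weight a b"
    by (auto simp: weight_def powr_diff field_simps)
qed

lemma weight_fixpoint:
  assumes "0 < a" "0 < b" "a = M * weight a b"
  shows "a * (a powr \<rho> + b powr \<rho>)\<^sup>2 = \<rho> * \<kappa> * a powr \<rho> * b powr \<rho> * M"
proof -
  have "0 < a powr \<rho>" "0 < b powr \<rho>" using assms by simp_all
  then have "0 < (a powr \<rho> + b powr \<rho>)\<^sup>2" by (intro zero_less_power add_pos_pos)
  then have "weight a b * (a powr \<rho> + b powr \<rho>)\<^sup>2 = \<rho> * \<kappa> * a powr \<rho> * b powr \<rho>"
    by (simp add: weight_def)
  then have "M * weight a b * (a powr \<rho> + b powr \<rho>)\<^sup>2 = \<rho> * \<kappa> * a powr \<rho> * b powr \<rho> * M"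
    by (simp add: mult_ac)
  then show ?thesis using assms(3) by simp
qed

lemma weight_commute: "weight a b = weight b a"
  by (simp add: weight_def add.commute mult_ac)

lemma m_equation_iff:
  assumes "0 < a" "0 < b" "a = M * weight a b" "M = m'' - m'"
  shows "2 * (a powr \<rho> + b powr \<rho>) * (m + a) = (a powr \<rho> * (1 - \<kappa>) + b powr \<rho> * (1 + \<kappa>)) * m' +
      (a powr \<rho> * (1 + \<kappa>) + b powr \<rho> * (1 - \<kappa>)) * m'' \<longleftrightarrow> m - m' = M * \<gamma> (b / a)"
  using weighted_step_iff[OF _ _ weight_fixpoint[OF assms(1,2,3)] refl refl assms(1,2), of m m'] assms(1,2)
  by (simp add: assms(4))

text \<open>The second equation is the first one with the players exchanged and the line reversed.\<close>

lemma n_equation_iff: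
  assumes "0 < a" "0 < b" "b = N * weight a b" "N = n' - n''"
  shows "2 * (a powr \<rho> + b powr \<rho>) * (n + b) = (a powr \<rho> * (1 - \<kappa>) + b powr \<rho> * (1 + \<kappa>)) * n' +
      (a powr \<rho> * (1 + \<kappa>) + b powr \<rho> * (1 - \<kappa>)) * n'' \<longleftrightarrow> n' - n = N * \<delta> (b / a)"
proof -
  have \<gamma>: "\<gamma> (a / b) = 1 - \<delta> (b / a)"
    using gamma_inverse[of "b / a"] assms(1,2) by simp
  have "b = N * weight b a" using assms(3) weight_commute by metis
  then have "2 * (b powr \<rho> + a powr \<rho>) * (n + b) = (b powr \<rho> * (1 - \<kappa>) + a powr \<rho> * (1 + \<kappa>)) * n'' +
      (b powr \<rho> * (1 + \<kappa>) + a powr \<rho> * (1 - \<kappa>)) * n' \<longleftrightarrow> n - n'' = N * \<gamma> (a / b)"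
    using assms by (intro m_equation_iff) auto
  also have "\<dots> \<longleftrightarrow> n' - n = N * \<delta> (b / a)"
    unfolding \<gamma> by (auto simp: assms(4) algebra_simps)
  finally show ?thesis by (simp add: algebra_simps)
qed

text \<open>Eliminates \<open>a\<close> and \<open>b\<close>: they are explicit in the double-step
  differences, and the quotient of these takes the place of \<open>b i / a i\<close> in
  \<open>\<gamma>\<close> and \<open>\<delta>\<close>.\<close>

lemma ABMN_iff:
  "(a, b, m, n) \<in> ABMN \<kappa> \<rho> \<longleftrightarrow> (\<forall>i.
    0 < m (i + 1) - m (i - 1) \<and> 0 < n (i - 1) - n (i + 1) \<and>
    a i = (m (i + 1) - m (i - 1)) * weight (m (i + 1) - m (i - 1)) (n (i - 1) - n (i + 1)) \<and>
    b i = (n (i - 1) - n (i + 1)) * weight (m (i + 1) - m (i - 1)) (n (i - 1) - n (i + 1)) \<and>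
    m i - m (i - 1) =
      (m (i + 1) - m (i - 1)) * \<gamma> ((n (i - 1) - n (i + 1)) / (m (i + 1) - m (i - 1))) \<and>
    n (i - 1) - n i =
      (n (i - 1) - n (i + 1)) * \<delta> ((n (i - 1) - n (i + 1)) / (m (i + 1) - m (i - 1))))"
  unfolding ABMN_def mem_Collect_eq prod.case
proof (rule all_cong1, goal_cases)
  case (1 i)
  define M where "M = m (i + 1) - m (i - 1)"
  define N where "N = n (i - 1) - n (i + 1)"
  have fixpoint: "0 < a i \<Longrightarrow> 0 < b i \<Longrightarrow> a i = M * weight (a i) (b i) \<and> b i = N * weight (a i) (b i)
      \<longleftrightarrow> 0 < M \<and> 0 < N \<and> a i = M * weight M N \<and> b i = N * weight M N"
    by (rule weight_fixpoint_iff)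
  have pos: "0 < a i" "0 < b i" if "0 < M \<and> 0 < N \<and> a i = M * weight M N \<and> b i = N * weight M N"
    using that weight_pos[of M N] by simp_all
  have ratio: "b i / a i = N / M" if "0 < M \<and> 0 < N \<and> a i = M * weight M N \<and> b i = N * weight M N"
    using that weight_pos[of M N] by simp
  show ?case
  \<comment> \<open>The first two equations can be rewritten only under these conditions; if they
    fail, both sides are false.\<close>
  proof (cases "0 < a i \<and> 0 < b i \<and> a i = M * weight (a i) (b i) \<and> b i = N * weight (a i) (b i)")
    case True
    then have ab: "0 < a i" "0 < b i" and w: "a i = M * weight (a i) (b i)" "b i = N * weight (a i) (b i)"
      by blast+
    have MN: "0 < M \<and> 0 < N \<and> a i = M * weight M N \<and> b i = N * weight M N"
      using fixpoint[OF ab] w by blast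
    show ?thesis
      unfolding M_def[symmetric] N_def[symmetric]
      unfolding difference_equation_iff[OF ab] m_equation_iff[OF ab w(1) M_def]
        n_equation_iff[OF ab w(2) N_def] ratio[OF MN]
      using ab w MN by blast
  next
    case False
    then show ?thesis
      unfolding M_def[symmetric] N_def[symmetric]
      using fixpoint pos difference_equation_iff by blast
  qed
qed

text \<open>Two consecutive differences add up to the first one times
  \<open>1 + (c - 1) = 1 / \<gamma>\<close>, and likewise with \<open>d\<close> and
  \<open>\<delta>\<close>. By \<open>diff_ratio\<close> the quotient \<open>N / M\<close> is then
  the \<open>\<beta>\<close> of the orbit point.\<close>

lemma default_differences:
  fixes i :: int
  assumes "0 < x"
  defines "M \<equiv> m_def_seq \<kappa> \<rho> x (i + 1) - m_def_seq \<kappa> \<rho> x (i - 1)"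
    and "N \<equiv> n_def_seq \<kappa> \<rho> x (i - 1) - n_def_seq \<kappa> \<rho> x (i + 1)"
  shows "0 < M" "0 < N" "a_def_seq \<kappa> \<rho> x i = M * weight M N" "b_def_seq \<kappa> \<rho> x i = N * weight M N"
    "m_def_seq \<kappa> \<rho> x i - m_def_seq \<kappa> \<rho> x (i - 1) = M * \<gamma> (N / M)"
    "n_def_seq \<kappa> \<rho> x (i - 1) - n_def_seq \<kappa> \<rho> x i = N * \<delta> (N / M)"
proof -
  have m: "m_def_seq \<kappa> \<rho> x (k + 1) - m_def_seq \<kappa> \<rho> x k = m_diff x k"
    and n: "n_def_seq \<kappa> \<rho> x k - n_def_seq \<kappa> \<rho> x (k + 1) = n_diff x k" for k
    using m_def_seq_properties[OF assms(1)] n_def_seq_properties[OF assms(1)] by blast+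
  have m1: "m_def_seq \<kappa> \<rho> x i - m_def_seq \<kappa> \<rho> x (i - 1) = m_diff x (i - 1)"
    and n1: "n_def_seq \<kappa> \<rho> x (i - 1) - n_def_seq \<kappa> \<rho> x i = n_diff x (i - 1)"
    using m[of "i - 1"] n[of "i - 1"] by simp_all
  have M: "M = m_diff x (i - 1) * c_iter \<kappa> \<rho> i x"
    unfolding M_def using m[of i] m1 m_diff_Suc[OF assms(1), of "i - 1"] by (simp add: algebra_simps)
  have N: "N = n_diff x (i - 1) * d_iter \<kappa> \<rho> i x"
    unfolding N_def using n[of i] n1 n_diff_Suc[OF assms(1), of "i - 1"] by (simp add: algebra_simps)
  have pos: "0 < m_diff x (i - 1)" "0 < n_diff x (i - 1)"
    using assms(1) by (rule m_diff_pos n_diff_pos)+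
  define \<beta> where "\<beta> = beta (S x i)"
  have \<beta>: "0 < \<beta>" "\<phi>\<^sub>0 \<beta> = S x i"
    unfolding \<beta>_def using assms(1) by (simp_all add: beta_pos phi0_beta s_iter_pos)
  note pos = pos gamma_pos[OF \<beta>(1)] delta_pos[OF \<beta>(1)]
  have c: "c_iter \<kappa> \<rho> i x = 1 / \<gamma> \<beta>" and d: "d_iter \<kappa> \<rho> i x = 1 / \<delta> \<beta>"
    by (simp_all add: c_iter_def d_iter_def c_fn_def d_fn_def \<beta>_def)
  show MN: "0 < M" "0 < N"
    unfolding M N c d using pos by simp_all
  show "a_def_seq \<kappa> \<rho> x i = M * weight M N" "b_def_seq \<kappa> \<rho> x i = N * weight M N"
    unfolding a_def_seq_def b_def_seq_def M_def[symmetric] N_def[symmetric] Let_def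
    using MN by (simp_all add: weight_def powr_add mult_ac)
  have "n_diff x (i - 1) = m_diff x (i - 1) * (\<beta> * \<delta> \<beta> / \<gamma> \<beta>)"
    using diff_ratio[OF assms(1), of "i - 1"] pos \<beta> by (simp add: phi0_eq field_simps)
  then have "N / M = \<beta>"
    unfolding M N c d using pos by simp
  then show "m_def_seq \<kappa> \<rho> x i - m_def_seq \<kappa> \<rho> x (i - 1) = M * \<gamma> (N / M)"
    "n_def_seq \<kappa> \<rho> x (i - 1) - n_def_seq \<kappa> \<rho> x i = N * \<delta> (N / M)"
    unfolding m1 n1 using pos by (simp_all add: M N c d)
qed

section \<open>Matching solutions with dilations of the default sequence\<close>

lemma dilation_default_iff:
  "(a, b, m, n) = dilation \<mu> (default_seq \<kappa> \<rho> x) \<longleftrightarrow>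
    (\<forall>i. a i = \<mu> * a_def_seq \<kappa> \<rho> x i \<and> b i = \<mu> * b_def_seq \<kappa> \<rho> x i \<and>
      m i = \<mu> * m_def_seq \<kappa> \<rho> x i \<and> n i = \<mu> * n_def_seq \<kappa> \<rho> x i)"
  by (auto simp: dilation_def default_seq_def)

lemma m_diff_minus_1: "m_diff x (- 1) = \<kappa>" and n_diff_minus_1: "n_diff x (- 1) = \<kappa> * x"
  by (simp_all add: m_diff_def n_diff_def prod_to_minus_1)

lemma default_start:
  assumes "0 < x"
  shows "m_def_seq \<kappa> \<rho> x 0 - m_def_seq \<kappa> \<rho> x (- 1) = \<kappa>"
    "n_def_seq \<kappa> \<rho> x (- 1) - n_def_seq \<kappa> \<rho> x 0 = \<kappa> * x"
  using m_def_seq_properties[OF assms, THEN conjunct2, rule_format, of "- 1"]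
    n_def_seq_properties[OF assms, THEN conjunct2, rule_format, of "- 1"]
  by (simp_all add: m_diff_minus_1 n_diff_minus_1)

lemma dilation_default_solution:
  assumes "0 < x" "0 < \<mu>" and eq: "(a, b, m, n) = dilation \<mu> (default_seq \<kappa> \<rho> x)"
  shows "(a, b, m, n) \<in> ABMN \<kappa> \<rho>" "(m \<longlongrightarrow> 0) at_bot" "(n \<longlongrightarrow> 0) at_top"
    "m 0 - m (- 1) = \<mu> * \<kappa>" "n (- 1) - n 0 = \<mu> * \<kappa> * x"
proof -
  have e: "a i = \<mu> * a_def_seq \<kappa> \<rho> x i" "b i = \<mu> * b_def_seq \<kappa> \<rho> x i"
    "m i = \<mu> * m_def_seq \<kappa> \<rho> x i" "n i = \<mu> * n_def_seq \<kappa> \<rho> x i" for i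
    using eq unfolding dilation_default_iff by blast+
  show "(a, b, m, n) \<in> ABMN \<kappa> \<rho>"
    unfolding ABMN_iff e right_diff_distrib[symmetric]
    using default_differences[OF assms(1)] assms(2) by (simp add: weight_scale)
  have m: "m = (\<lambda>i. \<mu> * m_def_seq \<kappa> \<rho> x i)" and n: "n = (\<lambda>i. \<mu> * n_def_seq \<kappa> \<rho> x i)"
    using e by blast+
  show "(m \<longlongrightarrow> 0) at_bot" "(n \<longlongrightarrow> 0) at_top"
    unfolding m n using m_def_seq_properties[OF assms(1)] n_def_seq_properties[OF assms(1)]
    by (auto intro: tendsto_mult_right_zero)
  show "m 0 - m (- 1) = \<mu> * \<kappa>" "n (- 1) - n 0 = \<mu> * \<kappa> * x"
    unfolding e right_diff_distrib[symmetric] default_start[OF assms(1)] by simp_all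
qed

text \<open>The successive quotients \<open>q i / p i\<close> form an orbit of \<open>s\<close>
  through \<open>x\<close>, which fixes every \<open>\<beta> i\<close> and hence all ratios of
  consecutive differences. Only the scale stays free; \<open>\<mu>\<close> compares
  \<open>p 0\<close> with its default value \<open>\<kappa>\<close>.\<close>

lemma solution_differences:
  assumes sol: "(a, b, m, n) \<in> ABMN \<kappa> \<rho>" and x: "(n (- 1) - n 0) / (m 0 - m (- 1)) = x"
  defines "\<mu> \<equiv> (m 0 - m (- 1)) / \<kappa>"
  shows "0 < \<mu>" "m (k + 1) - m k = \<mu> * m_diff x k" "n k - n (k + 1) = \<mu> * n_diff x k"
proof -
  define p where "p = (\<lambda>i. m i - m (i - 1))"
  define q where "q = (\<lambda>i. n (i - 1) - n i)"
  \<comment> \<open>The quotient \<open>N / M\<close> of the double-step differences around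
    \<open>i\<close>.\<close>
  define \<beta> where "\<beta> = (\<lambda>i. (q i + q (i + 1)) / (p i + p (i + 1)))"
  have M: "m (i + 1) - m (i - 1) = p i + p (i + 1)" and N: "n (i - 1) - n (i + 1) = q i + q (i + 1)" for i
    by (simp_all add: p_def q_def)
  have MN: "0 < p i + p (i + 1)" "0 < q i + q (i + 1)" for i
    using sol unfolding ABMN_iff M N by blast+
  then have \<beta>: "0 < \<beta> i" for i by (simp add: \<beta>_def)
  have pq: "p i = (p i + p (i + 1)) * \<gamma> (\<beta> i)" "q i = (q i + q (i + 1)) * \<delta> (\<beta> i)" for i
  proof -
    have "m i - m (i - 1) = p i" "n (i - 1) - n i = q i"
      "(q i + q (i + 1)) / (p i + p (i + 1)) = \<beta> i"
      by (simp_all add: p_def q_def \<beta>_def)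
    with sol[unfolded ABMN_iff M N, rule_format, of i]
    show "p i = (p i + p (i + 1)) * \<gamma> (\<beta> i)" "q i = (q i + q (i + 1)) * \<delta> (\<beta> i)"
      by metis+
  qed
  have pos: "0 < p i" "0 < q i" for i
    using pq[of i] MN[of i] gamma_pos[OF \<beta>[of i]] delta_pos[OF \<beta>[of i]] by (metis mult_pos_pos)+
  have p_Suc: "p (i + 1) = p i * (1 / \<gamma> (\<beta> i) - 1)" for i
    using pq(1)[of i] gamma_pos[OF \<beta>[of i]] by (simp add: field_simps)
  have q_Suc: "q (i + 1) = q i * (1 / \<delta> (\<beta> i) - 1)" for i
    using pq(2)[of i] delta_pos[OF \<beta>[of i]] by (simp add: field_simps)
  have X: "q i / p i = \<phi>\<^sub>0 (\<beta> i)" for i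
  proof -
    have "q i / p i = ((q i + q (i + 1)) * \<delta> (\<beta> i)) / ((p i + p (i + 1)) * \<gamma> (\<beta> i))"
      using pq[of i] by simp
    also have "\<dots> = \<beta> i * \<delta> (\<beta> i) / \<gamma> (\<beta> i)"
      by (simp add: \<beta>_def)
    finally show ?thesis using \<beta> by (simp add: phi0_eq)
  qed
  have X_pos: "0 < q i / p i" for i using pos by simp
  have X_Suc: "q (i + 1) / p (i + 1) = s (q i / p i)" for i
    unfolding s_map_ratio[OF X_pos] unfolding X c_fn_phi0[OF \<beta>] d_fn_phi0[OF \<beta>]
    unfolding X[symmetric] p_Suc q_Suc by simp
  have "q 0 / p 0 = x" using x by (simp add: p_def q_def)
  then have S: "S x i = \<phi>\<^sub>0 (\<beta> i)" for i
    using s_iter_unique[of "\<lambda>i. q i / p i", OF X_pos X_Suc] X by metis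
  have "0 < x" using X_pos[of 0] \<open>q 0 / p 0 = x\<close> by simp
  have c: "c_iter \<kappa> \<rho> i x = 1 / \<gamma> (\<beta> i)" and d: "d_iter \<kappa> \<rho> i x = 1 / \<delta> (\<beta> i)" for i
    using \<beta> by (simp_all add: c_iter_def d_iter_def S c_fn_phi0 d_fn_phi0)
  have ne: "c_iter \<kappa> \<rho> i x - 1 \<noteq> 0" "d_iter \<kappa> \<rho> i x - 1 \<noteq> 0" for i
    using c_iter_greater_1[OF \<open>0 < x\<close>, of i] d_iter_greater_1[OF \<open>0 < x\<close>, of i] by simp_all
  have "p (k + 1) = p (- 1 + 1) * prod_to (\<lambda>i. c_iter \<kappa> \<rho> i x - 1) k"
    by (rule prod_to_unique[where f = "\<lambda>k. p (k + 1)"]) (rule ne, simp only: c p_Suc)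
  moreover have "q (k + 1) = q (- 1 + 1) * prod_to (\<lambda>i. d_iter \<kappa> \<rho> i x - 1) k"
    by (rule prod_to_unique[where f = "\<lambda>k. q (k + 1)"]) (rule ne, simp only: d q_Suc)
  moreover have "q 0 = p 0 * x"
    using \<open>q 0 / p 0 = x\<close> pos(1)[of 0] by (simp add: field_simps)
  moreover have "p 0 = \<mu> * \<kappa>" using kappa_pos by (simp add: \<mu>_def p_def)
  ultimately show "m (k + 1) - m k = \<mu> * m_diff x k" "n k - n (k + 1) = \<mu> * n_diff x k"
    by (simp_all add: m_diff_def n_diff_def p_def q_def)
  show "0 < \<mu>" using pos(1)[of 0] kappa_pos by (simp add: \<mu>_def p_def)
qed

text \<open>After division by \<open>\<mu>\<close> the differences are the default ones, so the
  limits identify \<open>m\<close> and \<open>n\<close>; \<open>a\<close> and \<open>b\<close>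
  follow since \<open>weight\<close> ignores the scale.\<close>

lemma solution_is_dilation:
  assumes "0 < x" and sol: "(a, b, m, n) \<in> ABMN \<kappa> \<rho>"
    and lim: "(m \<longlongrightarrow> 0) at_bot" "(n \<longlongrightarrow> 0) at_top"
    and x: "(n (- 1) - n 0) / (m 0 - m (- 1)) = x"
  shows "\<exists>\<mu>>0. (a, b, m, n) = dilation \<mu> (default_seq \<kappa> \<rho> x)"
proof -
  define \<mu> where "\<mu> = (m 0 - m (- 1)) / \<kappa>"
  note diff = solution_differences[OF sol x, folded \<mu>_def]
  have "(\<lambda>k. m k / \<mu>) = m_def_seq \<kappa> \<rho> x"
  proof (rule forward_antidifference_unique[where D = "m_diff x"])
    show "((\<lambda>k. m k / \<mu>) \<longlongrightarrow> 0) at_bot" using tendsto_divide_zero[OF lim(1)] .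
    show "\<forall>k. m (k + 1) / \<mu> - m k / \<mu> = m_diff x k"
      using diff by (simp flip: diff_divide_distrib)
  qed (use m_def_seq_properties[OF assms(1)] in auto)
  then have m: "m k = \<mu> * m_def_seq \<kappa> \<rho> x k" for k
    using diff(1) by (auto simp: fun_eq_iff field_simps)
  have "(\<lambda>k. n k / \<mu>) = n_def_seq \<kappa> \<rho> x"
  proof (rule antidifference_unique[where D = "n_diff x"])
    show "((\<lambda>k. n k / \<mu>) \<longlongrightarrow> 0) at_top" using tendsto_divide_zero[OF lim(2)] .
    show "\<forall>k. n k / \<mu> - n (k + 1) / \<mu> = n_diff x k"
      using diff by (simp flip: diff_divide_distrib)
  qed (use n_def_seq_properties[OF assms(1)] in auto)
  then have n: "n k = \<mu> * n_def_seq \<kappa> \<rho> x k" for k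
    using diff(1) by (auto simp: fun_eq_iff field_simps)
  have "a i = \<mu> * a_def_seq \<kappa> \<rho> x i \<and> b i = \<mu> * b_def_seq \<kappa> \<rho> x i" for i
    using sol[unfolded ABMN_iff m n right_diff_distrib[symmetric], rule_format, of i]
      default_differences[OF assms(1), of i] diff(1) by (simp add: weight_scale)
  then show ?thesis
    using m n diff(1) unfolding dilation_default_iff by blast
qed

end

theorem theorem1p11:
  fixes \<kappa> \<rho> x :: real and a b m n :: "int \<Rightarrow> real"
  assumes "(\<kappa>, \<rho>) \<in> W" and "0 < x"
  shows "((a, b, m, n) \<in> ABMN \<kappa> \<rho> \<and> (m \<longlongrightarrow> 0) at_bot \<and> (n \<longlongrightarrow> 0) at_top \<and>
            (n (-1) - n 0) / (m 0 - m (-1)) = x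
          \<longleftrightarrow> (\<exists>\<mu>>0. (a, b, m, n) = dilation \<mu> (default_seq \<kappa> \<rho> x)))
       \<and> (\<forall>\<mu>>0. (a, b, m, n) = dilation \<mu> (default_seq \<kappa> \<rho> x)
                 \<longrightarrow> m 0 - m (-1) = \<mu> * \<kappa>)"
proof -
  interpret weights \<kappa> \<rho>
    using assms(1) by unfold_locales
  have "(n (- 1) - n 0) / (m 0 - m (- 1)) = x"
    if "0 < \<mu>" "(a, b, m, n) = dilation \<mu> (default_seq \<kappa> \<rho> x)" for \<mu>
    unfolding dilation_default_solution(4,5)[OF assms(2) that] using that(1) kappa_pos by simp
  moreover note dilation_default_solution(1-4)[OF assms(2), of _ a b m n]
  ultimately show ?thesis
    using solution_is_dilation[OF assms(2), of a b m n] by (intro conjI iffI allI impI) blast+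
qed

end
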